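(* Let $G:I\to\mathbb{R}$ be an upper semicontinuous function such that, for some constant $c\in\mathbb{R}$ and all $x\in I$, $$P_x\Big(\lim_{t\to\infty}e^{-rt}G(X_t)=c\Big)=1,\qquad E_x\Big[\sup_{t\ge 0}\big|e^{-rt}G(X_t)\big|\Big]<+\infty .$$ Define $W:(0,\infty)\to\mathbb{R}$ and $\widetilde W:(-\infty,0)\to\mathbb{R}$ by $W=(G/\psi)\circ F^{-1}$ and $\widetilde W=(G/\varphi)\circ\widetilde F^{-1}$, and assume $W(0+)=\widetilde W(0-)=0$. Let $$V(x)=\sup_{\tau}E_x\big[e^{-r\tau}G(X_\tau)\big],\qquad x\in I,$$ the supremum being over all stopping times $\tau$. Then for all $x\in I$ $$V(x)=W_{**}(F(x))\,\psi(x)=\widetilde W_{**}(\widetilde F(x))\,\varphi(x).$$ For each $x\in I$, the stopping time which attains the supremum defining $V(x)$ is $\tau^*=T_{a^*}\wedge T_{b^*}$, where $$a^*=\sup\{c\in(a,x]: W(F(c))=W_{**}(F(c))\},\qquad b^*=\inf\{c\in[x,b): W(F(c))=W_{**}(F(c))\},$$ with the convention $\sup\emptyset=a$, $\inf\emptyset=b$. Furthermore, $V=\inf_{U\in\mathrm{Sup}(G]}U$ (pointwise infimum), where $\mathrm{Sup}(G]$ is the set of all functions $U:I\to\mathbb{R}$ with $U\ge G$ that are continuous and $r$-superharmonic.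
   Context: Setting. $I=(a,b)\subseteq\mathbb{R}$ is an open interval and $X=(X_t)_{t\ge0}$ is a one-dimensional (continuous) diffusion with state space $I$ on a stochastic basis $(\Omega,\mathcal F,\mathbb F,\{P_x\}_{x\in I})$, with $X_0=x$ under $P_x$. Put $T_y=\inf\{t\ge0:X_t=y\}$. The boundaries are natural: $P_x(T_a<\infty)=P_x(T_b<\infty)=0$ for all $x\in I$. $X$ is regular: for all $x\in I$, $P_x(T_y<\infty)>0$ for some $y\in(x,b)$. The generator is $\mathbb{L}_Xf=\mu f'+Df''$ with drift $\mu$ and $D>0$. Fix $r>0$. The ODE $\mathbb{L}_Xf=rf$ on $I$ has two linearly independent positive solutions $\varphi$ (increasing) and $\psi$ (decreasing), continuous, strictly monotone and strictly convex, with $\varphi(a+)=\psi(b-)=0$ and $\varphi(b-)=\psi(a+)=+\infty$; moreover $E_x[e^{-rT_y}\mathbb{I}_{[T_y<\infty]}]=\psi(x)/\psi(y)$ for $x>y$ and $=\varphi(x)/\varphi(y)$ for $x\le y$. Put $F=\varphi/\psi:I\to(0,\infty)$ and $\widetilde F=-\psi/\varphi=-1/F:I\to(-\infty,0)$, both strictly increasing. $r$-superharmonic: a Borel function $U:I\to\mathbb{R}$ is $r$-superharmonic if $U(x)\ge E_x[e^{-r\tau}U(X_\tau)\mathbb{I}_{[\tau<\infty]}]$ for all $x\in I$ and all stopping times $\tau$. Concave biconjugate: for $f:\mathrm{dom}(f)\to\mathbb{R}$, put $f_*(c)=\inf_{y\in\mathrm{dom}(f)}(cy-f(y))$ and $f_{**}(x)=\inf_{c\in\mathrm{dom}(f_*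 )}(cx-f_*(c))$, where $\mathrm{dom}(f_* )$ is the set of $c\in\mathbb{R}$ with $f_*(c)$ finite; thus $f_{**}(x)=\inf_c\sup_{y\in\mathrm{dom}(f)}(c(x-y)+f(y))$. On $\{\tau=\infty\}$, $e^{-r\tau}G(X_\tau)$ is understood as $\lim_{t\to\infty}e^{-rt}G(X_t)$. *)

theory Defs
  imports "HOL-Probability.Probability"
begin

section \<open>Analytic notions\<close>

definition usc_on :: "'a::topological_space set \<Rightarrow> ('a \<Rightarrow> real) \<Rightarrow> bool" where
  "usc_on S f \<longleftrightarrow> (\<forall>c. openin (top_of_set S) {x \<in> S. f x < c})"

definition strictly_convex_on :: "real set \<Rightarrow> (real \<Rightarrow> real) \<Rightarrow> bool" where
  "strictly_convex_on S f \<longleftrightarrow> convex S \<and>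
     (\<forall>x\<in>S. \<forall>y\<in>S. \<forall>u. x \<noteq> y \<and> 0 < u \<and> u < 1 \<longrightarrow>
        f ((1 - u) * x + u * y) < (1 - u) * f x + u * f y)"

text \<open>The domain \<open>S\<close> of \<open>f\<close> is an explicit argument. The conjugates are extended-real valued, so
  that the infima are never arbitrary.\<close>

definition concave_conj :: "real set \<Rightarrow> (real \<Rightarrow> real) \<Rightarrow> real \<Rightarrow> ereal" where
  "concave_conj S f c = (INF y\<in>S. ereal (c * y - f y))"

definition concave_conj_dom :: "real set \<Rightarrow> (real \<Rightarrow> real) \<Rightarrow> real set" where
  "concave_conj_dom S f = {c. \<bar>concave_conj S f c\<bar> \<noteq> \<infinity>}"

definition concave_biconj :: "real set \<Rightarrow> (real \<Rightarrow> real) \<Rightarrow> real \<Rightarrow> ereal" where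
  "concave_biconj S f x = (INF c\<in>concave_conj_dom S f. ereal (c * x) - concave_conj S f c)"

definition C2_compact_support :: "real set \<Rightarrow> (real \<Rightarrow> real) set" where
  "C2_compact_support S =
     {f. (\<forall>x. f differentiable at x) \<and> (\<forall>x. deriv f differentiable at x) \<and>
         continuous_on UNIV (deriv (deriv f)) \<and>
         compact (closure {x. f x \<noteq> 0}) \<and> closure {x. f x \<noteq> 0} \<subseteq> S}"

definition diff_operator :: "(real \<Rightarrow> real) \<Rightarrow> (real \<Rightarrow> real) \<Rightarrow> (real \<Rightarrow> real) \<Rightarrow> real \<Rightarrow> real" where
  "diff_operator \<mu> D f x = \<mu> x * deriv f x + D x * deriv (deriv f) x"

definition solves_ode_on ::
  "real set \<Rightarrow> (real \<Rightarrow> real) \<Rightarrow> (real \<Rightarrow> real) \<Rightarrow> real \<Rightarrow> (real \<Rightarrow> real) \<Rightarrow> bool" where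
  "solves_ode_on S \<mu> D r f \<longleftrightarrow>
     (\<forall>x\<in>S. f differentiable at x \<and> deriv f differentiable at x \<and> diff_operator \<mu> D f x = r * f x)"


section \<open>Diffusions\<close>

text \<open>Extended expectation \<open>E[f\<^sup>+] - E[f\<^sup>-]\<close>. It is the usual expectation of an integrable \<open>f\<close>, and
  it is unchanged if \<open>f\<close> is modified on a null set, even when this destroys measurability of \<open>f\<close>.
  In the undefined case \<open>\<infinity> - \<infinity>\<close> it is \<open>\<infinity>\<close>, so that an upper bound by a real number is never
  satisfied by accident.\<close>

definition ext_expectation :: "'w measure \<Rightarrow> ('w \<Rightarrow> real) \<Rightarrow> ereal" where
  "ext_expectation M f =
     enn2ereal (\<integral>\<^sup>+ \<omega>. ennreal (f \<omega>) \<partial>M) - enn2ereal (\<integral>\<^sup>+ \<omega>. ennreal (- f \<omega>) \<partial>M)"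

text \<open>Processes are indexed by real times of which only the nonnegative ones matter; stopping times
  take values in \<open>[0, \<infinity>]\<close>, represented by \<open>ennreal\<close>. The level \<open>y\<close> is extended real because
  it may be an infinite endpoint of the state space.\<close>

definition hitting_time :: "(real \<Rightarrow> 'w \<Rightarrow> real) \<Rightarrow> ereal \<Rightarrow> 'w \<Rightarrow> ennreal" where
  "hitting_time X y \<omega> = Inf (ennreal ` {t. 0 \<le> t \<and> ereal (X t \<omega>) = y})"

definition path_space :: "(real \<Rightarrow> real) measure" where
  "path_space = (\<Pi>\<^sub>M t\<in>{0..}. borel)"

definition path_after :: "(real \<Rightarrow> 'w \<Rightarrow> real) \<Rightarrow> real \<Rightarrow> 'w \<Rightarrow> real \<Rightarrow> real" where
  "path_after X s \<omega> = (\<lambda>t\<in>{0..}. X (s + t) \<omega>)"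

definition path_law :: "(real \<Rightarrow> 'w measure) \<Rightarrow> (real \<Rightarrow> 'w \<Rightarrow> real) \<Rightarrow> real \<Rightarrow> (real \<Rightarrow> real) measure" where
  "path_law P X x = distr (P x) path_space (path_after X 0)"

text \<open>A continuous strong Markov process with state space \<open>(a, b)\<close> and generator
  \<open>\<mu> f' + D f''\<close>. The filtration is indexed by \<open>[0, \<infinity>]\<close> so that stopping times may be infinite;
  the condition in \<open>stopping_time\<close> is void at time \<open>\<infinity>\<close>, and \<open>Fil \<infinity>\<close> does not influence which
  functions are stopping times. No completeness or right-continuity of the filtration is imposed.\<close>

locale diffusion = filtration "space M" Fil
  for M :: "'w measure" and Fil :: "ennreal \<Rightarrow> 'w measure" +
  fixes a b :: ereal
    and P :: "real \<Rightarrow> 'w measure"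
    and X :: "real \<Rightarrow> 'w \<Rightarrow> real"
    and \<mu> D :: "real \<Rightarrow> real"
  assumes interval_nonempty: "a < b"
    and sets_Fil: "sets (Fil t) \<subseteq> sets M"
    and prob_space_P: "x \<in> einterval a b \<Longrightarrow> prob_space (P x)"
    and sets_P: "x \<in> einterval a b \<Longrightarrow> sets (P x) = sets M"
    and adapted: "0 \<le> t \<Longrightarrow> X t \<in> borel_measurable (Fil (ennreal t))"
    and state_space: "\<omega> \<in> space M \<Longrightarrow> 0 \<le> t \<Longrightarrow> X t \<omega> \<in> einterval a b"
    and continuous_paths: "\<omega> \<in> space M \<Longrightarrow> continuous_on {0..} (\<lambda>t. X t \<omega>)"
    and start: "x \<in> einterval a b \<Longrightarrow> AE \<omega> in P x. X 0 \<omega> = x"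
    and path_law_kernel:
      "path_law P X \<in> restrict_space borel (einterval a b) \<rightarrow>\<^sub>M prob_algebra path_space"
    and strong_Markov:
      "\<lbrakk>x \<in> einterval a b; stopping_time Fil \<tau>; A \<in> sets (pre_sigma \<tau>); B \<in> sets path_space\<rbrakk> \<Longrightarrow>
         emeasure (P x) {\<omega> \<in> A. \<tau> \<omega> < \<infinity> \<and> path_after X (enn2real (\<tau> \<omega>)) \<omega> \<in> B} =
         (\<integral>\<^sup>+ \<omega>. emeasure (path_law P X (X (enn2real (\<tau> \<omega>)) \<omega>)) B *
            indicator {\<omega> \<in> A. \<tau> \<omega> < \<infinity>} \<omega> \<partial>P x)"
    and D_pos: "x \<in> einterval a b \<Longrightarrow> 0 < D x"
    and generator:
      "\<lbrakk>f \<in> C2_compact_support (einterval a b); x \<in> einterval a b\<rbrakk> \<Longrightarrow>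
         ((\<lambda>t. ((\<integral>\<omega>. f (X t \<omega>) \<partial>P x) - f x) / t) \<longlongrightarrow> diff_operator \<mu> D f x) (at_right 0)"

text \<open>Since paths stay in the open interval \<open>(a, b)\<close> at all finite times, the two naturality
  conditions already follow from \<open>state_space\<close>; they are kept as part of the setting. Likewise
  linear independence and continuity of \<open>\<phi>\<close>, \<open>\<psi>\<close> follow from other conditions.
  One-sided limits at the possibly infinite endpoints are taken along \<open>at_right a\<close> and
  \<open>at_left b\<close> in the extended reals.\<close>

locale natural_regular_diffusion = diffusion M Fil a b P X \<mu> D
  for M :: "'w measure" and Fil :: "ennreal \<Rightarrow> 'w measure" and a b :: ereal
    and P :: "real \<Rightarrow> 'w measure" and X :: "real \<Rightarrow> 'w \<Rightarrow> real" and \<mu> D :: "real \<Rightarrow> real" +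
  fixes r :: real and \<phi> \<psi> :: "real \<Rightarrow> real"
  assumes natural_left:
      "x \<in> einterval a b \<Longrightarrow> measure (P x) {\<omega> \<in> space (P x). hitting_time X a \<omega> < \<infinity>} = 0"
    and natural_right:
      "x \<in> einterval a b \<Longrightarrow> measure (P x) {\<omega> \<in> space (P x). hitting_time X b \<omega> < \<infinity>} = 0"
    and regular:
      "x \<in> einterval a b \<Longrightarrow> \<exists>y\<in>einterval (ereal x) b.
         0 < measure (P x) {\<omega> \<in> space (P x). hitting_time X (ereal y) \<omega> < \<infinity>}"
    and r_pos: "0 < r"
    and \<phi>_ode: "solves_ode_on (einterval a b) \<mu> D r \<phi>"
    and \<psi>_ode: "solves_ode_on (einterval a b) \<mu> D r \<psi>"
    and lin_indep:
      "(\<And>x. x \<in> einterval a b \<Longrightarrow> \<alpha> * \<phi> x + \<beta> * \<psi> x = 0) \<Longrightarrow> \<alpha> = 0 \<and> \<beta> = 0"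
    and \<phi>_pos: "x \<in> einterval a b \<Longrightarrow> 0 < \<phi> x"
    and \<psi>_pos: "x \<in> einterval a b \<Longrightarrow> 0 < \<psi> x"
    and \<phi>_continuous: "continuous_on (einterval a b) \<phi>"
    and \<psi>_continuous: "continuous_on (einterval a b) \<psi>"
    and \<phi>_increasing: "strict_mono_on (einterval a b) \<phi>"
    and \<psi>_decreasing: "strict_antimono_on (einterval a b) \<psi>"
    and \<phi>_convex: "strictly_convex_on (einterval a b) \<phi>"
    and \<psi>_convex: "strictly_convex_on (einterval a b) \<psi>"
    and \<phi>_left: "((\<phi> \<circ> real_of_ereal) \<longlongrightarrow> 0) (at_right a)"
    and \<psi>_right: "((\<psi> \<circ> real_of_ereal) \<longlongrightarrow> 0) (at_left b)"
    and \<phi>_right: "filterlim (\<phi> \<circ> real_of_ereal) at_top (at_left b)"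
    and \<psi>_left: "filterlim (\<psi> \<circ> real_of_ereal) at_top (at_right a)"
    and hitting_laplace_down:
      "\<lbrakk>x \<in> einterval a b; y \<in> einterval a b; y < x\<rbrakk> \<Longrightarrow>
         (\<integral>\<omega>. exp (- r * enn2real (hitting_time X (ereal y) \<omega>)) *
            indicator {\<omega>. hitting_time X (ereal y) \<omega> < \<infinity>} \<omega> \<partial>P x) = \<psi> x / \<psi> y"
    and hitting_laplace_up:
      "\<lbrakk>x \<in> einterval a b; y \<in> einterval a b; x \<le> y\<rbrakk> \<Longrightarrow>
         (\<integral>\<omega>. exp (- r * enn2real (hitting_time X (ereal y) \<omega>)) *
            indicator {\<omega>. hitting_time X (ereal y) \<omega> < \<infinity>} \<omega> \<partial>P x) = \<phi> x / \<phi> y"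


section \<open>Optimal stopping\<close>

definition discounted_reward ::
  "real \<Rightarrow> (real \<Rightarrow> 'w \<Rightarrow> real) \<Rightarrow> (real \<Rightarrow> real) \<Rightarrow> ('w \<Rightarrow> ennreal) \<Rightarrow> 'w \<Rightarrow> real" where
  "discounted_reward r X G \<tau> \<omega> =
     (if \<tau> \<omega> = \<infinity> then Lim at_top (\<lambda>t. exp (- r * t) * G (X t \<omega>))
      else exp (- r * enn2real (\<tau> \<omega>)) * G (X (enn2real (\<tau> \<omega>)) \<omega>))"

definition stopping_value ::
  "(ennreal \<Rightarrow> 'w measure) \<Rightarrow> (real \<Rightarrow> 'w measure) \<Rightarrow> (real \<Rightarrow> 'w \<Rightarrow> real) \<Rightarrow> real \<Rightarrow>
   (real \<Rightarrow> real) \<Rightarrow> real \<Rightarrow> ereal" where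
  "stopping_value Fil P X r G x =
     (SUP \<tau>\<in>{\<tau>. stopping_time Fil \<tau>}. ext_expectation (P x) (discounted_reward r X G \<tau>))"

definition r_superharmonic ::
  "(ennreal \<Rightarrow> 'w measure) \<Rightarrow> (real \<Rightarrow> 'w measure) \<Rightarrow> (real \<Rightarrow> 'w \<Rightarrow> real) \<Rightarrow> real set \<Rightarrow> real \<Rightarrow>
   (real \<Rightarrow> real) \<Rightarrow> bool" where
  "r_superharmonic Fil P X S r U \<longleftrightarrow>
     U \<in> borel_measurable (restrict_space borel S) \<and>
     (\<forall>x\<in>S. \<forall>\<tau>. stopping_time Fil \<tau> \<longrightarrow>
        ext_expectation (P x) (\<lambda>\<omega>. exp (- r * enn2real (\<tau> \<omega>)) * U (X (enn2real (\<tau> \<omega>)) \<omega>) *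
          indicator {\<omega>. \<tau> \<omega> < \<infinity>} \<omega>) \<le> ereal (U x))"

definition superharmonic_majorants ::
  "(ennreal \<Rightarrow> 'w measure) \<Rightarrow> (real \<Rightarrow> 'w measure) \<Rightarrow> (real \<Rightarrow> 'w \<Rightarrow> real) \<Rightarrow> real set \<Rightarrow> real \<Rightarrow>
   (real \<Rightarrow> real) \<Rightarrow> (real \<Rightarrow> real) set" where
  "superharmonic_majorants Fil P X S r G =
     {U. (\<forall>x\<in>S. G x \<le> U x) \<and> continuous_on S U \<and> r_superharmonic Fil P X S r U}"

text \<open>The nearest points of \<open>C\<close> to the left and to the right of \<open>x\<close>, with the endpoints \<open>a\<close> and
  \<open>b\<close> as values where there are none (the plain \<open>Sup\<close> and \<open>Inf\<close> of the empty set in \<open>ereal\<close>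
  would be \<open>-\<infinity>\<close> and \<open>\<infinity>\<close>).\<close>

definition left_contact :: "ereal \<Rightarrow> real set \<Rightarrow> real \<Rightarrow> ereal" where
  "left_contact a C x =
     (let S = {c \<in> C. a < ereal c \<and> c \<le> x} in if S = {} then a else Sup (ereal ` S))"

definition right_contact :: "ereal \<Rightarrow> real set \<Rightarrow> real \<Rightarrow> ereal" where
  "right_contact b C x =
     (let S = {c \<in> C. x \<le> c \<and> ereal c < b} in if S = {} then b else Inf (ereal ` S))"

end

theory Submission
  imports Defs
begin

text \<open>Write \<open>W\<^sub>*\<^sub>*\<close> for the biconjugate of \<open>W\<close>: it is the lower envelope of the lines above \<open>W\<close>. A line
  \<open>y \<mapsto> p y + q\<close> above \<open>W\<close> has \<open>p, q \<ge> 0\<close> and corresponds to the majorant \<open>h = p \<phi> + q \<psi>\<close> of \<open>G\<close>.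
  By the strong Markov property the map \<open>z \<mapsto> E\<^sub>z[exp (- r T\<^sub>y)]\<close>, which is a multiple of \<open>\<phi>\<close> below
  \<open>y\<close> and of \<open>\<psi>\<close> above \<open>y\<close>, is \<open>r\<close>-superharmonic, with equality for stopping times before \<open>T\<^sub>y\<close>.
  Letting \<open>y\<close> tend to \<open>b\<close> and \<open>a\<close>, so are \<open>\<phi>\<close> and \<open>\<psi>\<close>, hence \<open>h\<close>; thus \<open>V\<close> is below every
  superharmonic majorant and in particular below \<open>h\<close>. For fixed \<open>x\<close> the infimum of the lines at
  \<open>F x\<close> is attained. If the minimal line had \<open>q > 0\<close> but did not touch \<open>W\<close> to the left of \<open>F x\<close>, it
  could be rotated downwards, and similarly for \<open>p > 0\<close> on the right. Therefore \<open>h = G\<close> at those of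
  \<open>a\<^sup>*\<close>, \<open>b\<^sup>*\<close> that lie in the interval, \<open>q = 0\<close> if \<open>a\<^sup>* = a\<close>, and \<open>p = 0\<close> if \<open>b\<^sup>* = b\<close>; in all cases
  stopping at \<open>\<tau>\<^sup>*\<close> yields exactly \<open>h x\<close>. Paths with \<open>\<tau>\<^sup>* = \<infinity>\<close> contribute nothing, since the Markov
  property forces \<open>c = exp r * c\<close>.\<close>

section \<open>Upper semicontinuous functions\<close>

text \<open>A sum is below \<open>c\<close> exactly when some real \<open>q\<close> lies between
  \<open>f x\<close> and \<open>c - g x\<close>, so the sublevel set is a union of intersections of
  relatively open sets.\<close>

lemma usc_on_add_continuous:
  fixes f g :: "'a::topological_space \<Rightarrow> real"
  assumes f: "usc_on S f" and g: "continuous_on S g"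
  shows "usc_on S (\<lambda>x. f x + g x)"
  unfolding usc_on_def
proof
  fix c
  have "{x \<in> S. f x + g x < c} = (\<Union>q. {x \<in> S. f x < q} \<inter> (S \<inter> g -` {..<c - q}))"
  proof safe
    fix x assume "x \<in> S" "f x + g x < c"
    then obtain q where "f x < q" "q < c - g x"
      using dense[of "f x" "c - g x"] by auto
    then show "x \<in> (\<Union>q. {x \<in> S. f x < q} \<inter> (S \<inter> g -` {..<c - q}))"
      using \<open>x \<in> S\<close> by (auto simp: algebra_simps intro!: exI[of _ q])
  qed auto
  also have "openin (top_of_set S) \<dots>"
    using f by (intro openin_Union[OF imageE] openin_clauses(2) openin_Int continuous_openin_preimage_gen[OF g])
      (auto simp: usc_on_def intro!: openin_Int continuous_openin_preimage_gen[OF g])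
  finally show "openin (top_of_set S) {x \<in> S. f x + g x < c}" .
qed

text \<open>Dividing by \<open>g x > 0\<close> turns \<open>f x * g x < c\<close> into
  \<open>f x - c / g x < 0\<close>, which reduces the product to a sum whatever the signs of
  \<open>f\<close> and \<open>c\<close>.\<close>

lemma usc_on_mult_continuous:
  fixes f g :: "'a::topological_space \<Rightarrow> real"
  assumes f: "usc_on S f" and g: "continuous_on S g" and pos: "\<And>x. x \<in> S \<Longrightarrow> 0 < g x"
  shows "usc_on S (\<lambda>x. f x * g x)"
  unfolding usc_on_def
proof
  fix c
  have "usc_on S (\<lambda>x. f x + - c / g x)"
    using pos by (intro usc_on_add_continuous f continuous_intros g) force
  then have "openin (top_of_set S) {x \<in> S. f x + - c / g x < 0}"
    unfolding usc_on_def by blast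
  also have "{x \<in> S. f x + - c / g x < 0} = {x \<in> S. f x * g x < c}"
    using pos by (auto simp: field_simps)
  finally show "openin (top_of_set S) {x \<in> S. f x * g x < c}" .
qed

lemma usc_on_compose:
  assumes f: "usc_on T f" and g: "continuous_on S g" "g \<in> S \<rightarrow> T"
  shows "usc_on S (\<lambda>x. f (g x))"
  unfolding usc_on_def
proof
  fix c
  have "openin (top_of_set S) (S \<inter> g -` {x \<in> T. f x < c})"
    using f g by (intro continuous_openin_preimage[where T = T]) (auto simp: usc_on_def)
  also have "S \<inter> g -` {x \<in> T. f x < c} = {x \<in> S. f (g x) < c}"
    using g(2) by auto
  finally show "openin (top_of_set S) {x \<in> S. f (g x) < c}" .
qed

lemma usc_on_imp_borel_measurable:
  fixes f :: "'a::topological_space \<Rightarrow> real"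
  assumes "usc_on S f"
  shows "f \<in> borel_measurable (restrict_space borel S)"
proof (rule borel_measurableI_less)
  fix c
  obtain T where "open T" "{x \<in> S. f x < c} = S \<inter> T"
    using assms unfolding usc_on_def openin_open by blast
  then show "{x \<in> space (restrict_space borel S). f x < c} \<in> sets (restrict_space borel S)"
    by (auto simp: space_restrict_space sets_restrict_space)
qed

lemma usc_on_closed_superlevel:
  fixes f :: "'a::topological_space \<Rightarrow> real"
  assumes f: "usc_on S f" and K: "closed K" "K \<subseteq> S"
  shows "closed {x \<in> K. c \<le> f x}"
proof -
  obtain T where T: "open T" "{x \<in> S. f x < c} = S \<inter> T"
    using f unfolding usc_on_def openin_open by blast
  then have "{x \<in> K. c \<le> f x} = K - T"
    using K(2) by (auto simp: set_eq_iff not_le[symmetric])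
  then show ?thesis
    using T K by auto
qed

text \<open>Without a maximum the relatively open sets \<open>{x \<in> S. f x < f y}\<close>,
  \<open>y \<in> K\<close>, would cover \<open>K\<close>; but the index with the largest value in a
  finite subcover is left uncovered.\<close>

lemma usc_on_attains_sup:
  fixes f :: "'a::topological_space \<Rightarrow> real"
  assumes f: "usc_on S f" and K: "compact K" "K \<subseteq> S" "K \<noteq> {}"
  shows "\<exists>m\<in>K. \<forall>x\<in>K. f x \<le> f m"
proof (rule ccontr)
  assume "\<not> ?thesis"
  then have neg: "\<forall>m\<in>K. \<exists>y\<in>K. f m < f y"
    by (auto simp: not_le)
  have "\<exists>T. open T \<and> {x \<in> S. f x < f y} = S \<inter> T" for y
    using f unfolding usc_on_def openin_open by blast
  then obtain T where T: "\<And>y. open (T y)" "\<And>y. {x \<in> S. f x < f y} = S \<inter> T y"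
    by metis
  have "K \<subseteq> (\<Union>y\<in>K. T y)"
  proof
    fix x assume "x \<in> K"
    then obtain y where "y \<in> K" "f x < f y"
      using neg by blast
    then show "x \<in> (\<Union>y\<in>K. T y)"
      using T(2)[of y] K(2) \<open>x \<in> K\<close> by blast
  qed
  then obtain C where C: "C \<subseteq> K" "finite C" "K \<subseteq> (\<Union>y\<in>C. T y)"
    using compactE_image[OF K(1), of K T] T(1) by metis
  have "C \<noteq> {}"
    using C(3) K(3) by auto
  then have "Max (f ` C) \<in> f ` C"
    using C(2) by simp
  then obtain m where m: "m \<in> C" "f m = Max (f ` C)"
    by auto
  obtain y where y: "y \<in> C" "m \<in> T y"
    using m(1) C(1,3) by blast
  then have "f m < f y"
    using T(2)[of y] C(1) K(2) m(1) by blast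
  then show False
    using m(2) y(1) C(2) by (simp add: leD)
qed

section \<open>Affine majorants\<close>

definition affine_majorants :: "real set \<Rightarrow> (real \<Rightarrow> real) \<Rightarrow> (real \<times> real) set" where
  "affine_majorants S f = {(p, q). \<forall>y\<in>S. f y \<le> p * y + q}"

text \<open>At slope \<open>p\<close> the conjugate is minus the least intercept of a line above
  \<open>f\<close>, so the slopes in its domain are exactly those of the affine majorants.\<close>

lemma concave_biconj_eq_INF_affine:
  assumes "S \<noteq> {}"
  shows "concave_biconj S f x = (INF (p, q)\<in>affine_majorants S f. ereal (p * x + q))"
proof (rule antisym)
  show "concave_biconj S f x \<le> (INF (p, q)\<in>affine_majorants S f. ereal (p * x + q))"
  proof (rule INF_greatest, clarify)
    fix p q assume "(p, q) \<in> affine_majorants S f"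
    then have le: "ereal (- q) \<le> concave_conj S f p"
      unfolding concave_conj_def affine_majorants_def by (intro INF_greatest) (auto simp: algebra_simps)
    \<comment> \<open>A point of \<open>S\<close> bounds the conjugate from above; together with
      \<open>le\<close> this makes it finite.\<close>
    obtain y where "y \<in> S"
      using assms by auto
    then have "concave_conj S f p \<le> ereal (p * y - f y)"
      unfolding concave_conj_def by (rule INF_lower)
    with le obtain m where m: "concave_conj S f p = ereal m"
      by (cases "concave_conj S f p") auto
    then have "concave_biconj S f x \<le> ereal (p * x) - concave_conj S f p"
      unfolding concave_biconj_def concave_conj_dom_def by (intro INF_lower) auto
    also have "\<dots> \<le> ereal (p * x + q)"
      using le m by auto
    finally show "concave_biconj S f x \<le> ereal (p * x + q)" .
  qed
  show "(INF (p, q)\<in>affine_majorants S f. ereal (p * x + q)) \<le> concave_biconj S f x"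
    unfolding concave_biconj_def
  proof (rule INF_greatest)
    fix p assume "p \<in> concave_conj_dom S f"
    then obtain m where m: "concave_conj S f p = ereal m"
      unfolding concave_conj_dom_def by auto
    have "f y \<le> p * y + - m" if "y \<in> S" for y
      using INF_lower[OF that, of "\<lambda>y. ereal (p * y - f y)"] m unfolding concave_conj_def by auto
    then have "(p, - m) \<in> affine_majorants S f"
      unfolding affine_majorants_def by auto
    then show "(INF (p, q)\<in>affine_majorants S f. ereal (p * x + q)) \<le> ereal (p * x) - concave_conj S f p"
      by (rule INF_lower2) (simp add: m)
  qed
qed

text \<open>Minimality concerns the value at \<open>x\<close>, not contact: the line may lie
  strictly above \<open>w\<close> at \<open>x\<close>, where it represents the biconjugate.\<close>

definition supporting_line :: "(real \<Rightarrow> real) \<Rightarrow> real \<Rightarrow> real \<Rightarrow> real \<Rightarrow> bool" where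
  "supporting_line w x p q \<longleftrightarrow> (p, q) \<in> affine_majorants {0<..} w \<and>
     (\<forall>(p', q')\<in>affine_majorants {0<..} w. p * x + q \<le> p' * x + q')"

lemma supporting_lineD:
  assumes "supporting_line w x p q"
  shows "0 < y \<Longrightarrow> w y \<le> p * y + q"
    and "(p', q') \<in> affine_majorants {0<..} w \<Longrightarrow> p * x + q \<le> p' * x + q'"
  using assms by (auto simp: supporting_line_def affine_majorants_def)

lemma concave_biconj_supporting_line:
  assumes "supporting_line w x p q"
  shows "concave_biconj {0<..} w x = ereal (p * x + q)"
proof -
  have "(INF (p, q)\<in>affine_majorants {0<..} w. ereal (p * x + q)) = ereal (p * x + q)"
    using assms unfolding supporting_line_def
    by (intro antisym INF_greatest INF_lower2[of "(p, q)"]) auto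
  then show ?thesis
    by (simp add: concave_biconj_eq_INF_affine)
qed

text \<open>Dividing \<open>w y \<le> p * y + q\<close> by \<open>y\<close> and substituting
  \<open>z = - 1 / y\<close> gives a line above \<open>w'\<close> with slope \<open>- q\<close> and
  intercept \<open>p\<close>. This is a bijection of majorants, and corresponding values differ by
  the factor \<open>1 / x\<close>.\<close>

lemma concave_biconj_reflected_supporting_line:
  assumes sl: "supporting_line w x p q" and "0 < x"
    and w': "\<And>z. z < 0 \<Longrightarrow> w' z = - z * w (- 1 / z)"
  shows "concave_biconj {..<0} w' (- 1 / x) = ereal (p + q / x)"
proof -
  have maj: "(p', q') \<in> affine_majorants {..<0} w' \<longleftrightarrow> (q', - p') \<in> affine_majorants {0<..} w" for p' q'
  proof
    assume *: "(p', q') \<in> affine_majorants {..<0} w'"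
    have "w y \<le> q' * y + - p'" if "0 < y" for y
    proof -
      have "w' (- 1 / y) \<le> p' * (- 1 / y) + q'"
        using * that unfolding affine_majorants_def by (auto dest: bspec[where x = "- 1 / y"])
      moreover have "w' (- 1 / y) = w y / y"
        using that w'[of "- 1 / y"] by simp
      ultimately have "y * (w y / y) \<le> y * (p' * (- 1 / y) + q')"
        using that by (intro mult_left_mono) auto
      then show ?thesis
        using that by (simp add: algebra_simps)
    qed
    then show "(q', - p') \<in> affine_majorants {0<..} w"
      by (auto simp: affine_majorants_def)
  next
    assume *: "(q', - p') \<in> affine_majorants {0<..} w"
    have "w' z \<le> p' * z + q'" if "z < 0" for z
    proof -
      have "w (- 1 / z) \<le> q' * (- 1 / z) + - p'"
        using * that unfolding affine_majorants_def by (auto simp: divide_neg_neg dest: bspec[where x = "- 1 / z"])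
      then have "- z * w (- 1 / z) \<le> - z * (q' * (- 1 / z) + - p')"
        using that by (intro mult_left_mono) auto
      then show ?thesis
        using that w'[of z] by (simp add: algebra_simps)
    qed
    then show "(p', q') \<in> affine_majorants {..<0} w'"
      by (auto simp: affine_majorants_def)
  qed
  have "(INF (p', q')\<in>affine_majorants {..<0} w'. ereal (p' * (- 1 / x) + q')) = ereal (p + q / x)"
  proof (rule antisym)
    have "(- q, p) \<in> affine_majorants {..<0} w'"
      using sl unfolding maj supporting_line_def by simp
    then show "(INF (p', q')\<in>affine_majorants {..<0} w'. ereal (p' * (- 1 / x) + q')) \<le> ereal (p + q / x)"
      by (rule INF_lower2) simp
    show "ereal (p + q / x) \<le> (INF (p', q')\<in>affine_majorants {..<0} w'. ereal (p' * (- 1 / x) + q'))"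
    proof (rule INF_greatest, clarify)
      fix p' q' assume "(p', q') \<in> affine_majorants {..<0} w'"
      then have "p * x + q \<le> q' * x + - p'"
        using supporting_lineD(2)[OF sl] maj by blast
      then have "(p * x + q) / x \<le> (q' * x + - p') / x"
        using \<open>0 < x\<close> by (intro divide_right_mono) auto
      then show "ereal (p + q / x) \<le> ereal (p' * (- 1 / x) + q')"
        using \<open>0 < x\<close> by (simp add: add_divide_distrib diff_divide_distrib)
    qed
  qed
  moreover have "{..<0::real} \<noteq> {}"
    by (auto intro: exI[of _ "-1"])
  ultimately show ?thesis
    by (simp add: concave_biconj_eq_INF_affine)
qed

text \<open>Every line above \<open>w\<close> is at least \<open>w y\<close> at \<open>y\<close>,
  and the given line attains this bound.\<close>

lemma concave_biconj_eq_of_contact: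
  assumes "supporting_line w x p q" and "0 < y" "w y = p * y + q"
  shows "ereal (w y) = concave_biconj {0<..} w y"
proof -
  have "(INF (p, q)\<in>affine_majorants {0<..} w. ereal (p * y + q)) = ereal (w y)"
    using assms unfolding supporting_line_def
    by (intro antisym INF_greatest INF_lower2[of "(p, q)"])
      (auto simp: affine_majorants_def assms(3)[symmetric])
  then show ?thesis
    by (simp add: concave_biconj_eq_INF_affine)
qed

text \<open>The two limits are the conditions on \<open>W\<close> at \<open>0+\<close> and on its
  reflection at \<open>0-\<close>, since the reflection takes the value \<open>w y / y\<close> at
  \<open>- 1 / y\<close>.\<close>

locale sublinear_gain =
  fixes w :: "real \<Rightarrow> real"
  assumes usc: "usc_on {0<..} w"
    and zero: "(w \<longlongrightarrow> 0) (at_right 0)"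
    and infinity: "((\<lambda>y. w y / y) \<longlongrightarrow> 0) at_top"
begin

abbreviation "majorants \<equiv> affine_majorants {0<..} w"

text \<open>Letting \<open>y\<close> tend to infinity in \<open>w y / y \<le> p + q / y\<close>
  bounds \<open>p\<close>; letting \<open>y\<close> tend to \<open>0\<close> in
  \<open>w y \<le> p * y + q\<close> bounds \<open>q\<close>.\<close>

lemma majorants_nonneg:
  assumes "(p, q) \<in> majorants"
  shows "0 \<le> p" "0 \<le> q"
proof -
  have le: "w y \<le> p * y + q" if "0 < y" for y
    using assms that by (auto simp: affine_majorants_def)
  have "((\<lambda>y. p + q / y) \<longlongrightarrow> p + 0) at_top"
    by (intro tendsto_intros tendsto_divide_0[OF tendsto_const] filterlim_at_top_imp_at_infinity filterlim_ident)
  moreover have "eventually (\<lambda>y. w y / y \<le> p + q / y) at_top"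
    using eventually_gt_at_top[of 0] by eventually_elim (use le in \<open>simp add: field_simps\<close>)
  ultimately show "0 \<le> p"
    using tendsto_le[OF trivial_limit_at_top_linorder _ infinity] by fastforce
  have "((\<lambda>y. p * y + q) \<longlongrightarrow> p * 0 + q) (at_right 0)"
    by (intro tendsto_intros)
  moreover have "eventually (\<lambda>y. w y \<le> p * y + q) (at_right 0)"
    using eventually_at_right_less[of 0] by eventually_elim (rule le)
  ultimately show "0 \<le> q"
    using tendsto_le[OF trivial_limit_at_right_real _ zero] by fastforce
qed

text \<open>Near \<open>0\<close> the gain is below \<open>1\<close>, far out it is below
  \<open>y\<close>, and on the compact interval between it has a maximum; slope \<open>1\<close>
  with a large intercept covers all three ranges.\<close>

lemma majorants_nonempty: "majorants \<noteq> {}"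
proof -
  have "eventually (\<lambda>y. w y < 1) (at_right 0)"
    using order_tendstoD(2)[OF zero, of 1] by simp
  then obtain s where s: "0 < s" "\<And>y. 0 < y \<Longrightarrow> y < s \<Longrightarrow> w y < 1"
    unfolding eventually_at_right_field by auto
  \<comment> \<open>The conjunct \<open>s < y\<close> guarantees \<open>s < N\<close>, so that
    \<open>{s..N}\<close> is nonempty.\<close>
  have "eventually (\<lambda>y. w y / y < 1 \<and> s < y) at_top"
    using order_tendstoD(2)[OF infinity, of 1] by (intro eventually_conj eventually_gt_at_top) simp
  then obtain N where N: "\<And>y. N \<le> y \<Longrightarrow> w y / y < 1 \<and> s < y"
    unfolding eventually_at_top_linorder by auto
  have "{s..N} \<noteq> {}" using N[of N] by auto
  then obtain m where m: "\<forall>y\<in>{s..N}. w y \<le> w m"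
    using usc_on_attains_sup[OF usc, of "{s..N}"] s by force
  have "w y \<le> 1 * y + max 1 (w m)" if "0 < y" for y
  proof -
    consider "y < s" | "y \<in> {s..N}" | "N \<le> y"
      by force
    then show ?thesis
    proof cases
      case 3
      then have "w y < y"
        using N[of y] that by (simp add: field_simps)
      then show ?thesis
        by linarith
    qed (use s(2)[of y] m that in force)+
  qed
  then have "(1, max 1 (w m)) \<in> majorants"
    by (auto simp: affine_majorants_def)
  then show ?thesis
    by auto
qed

text \<open>Majorants that do not exceed a given one at \<open>x\<close> form a closed set, which
  nonnegativity of slope and intercept confines to a rectangle; on this compact set the value at
  \<open>x\<close> attains its minimum.\<close>

lemma supporting_line_exists:
  assumes "0 < x"
  obtains p q where "supporting_line w x p q"
proof -
  obtain p0 q0 where pq0: "(p0, q0) \<in> majorants"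
    using majorants_nonempty by auto
  define K where "K = p0 * x + q0"
  define L where "L = majorants \<inter> {z. fst z * x + snd z \<le> K}"
  have "closed majorants"
  proof -
    have "majorants = (\<Inter>y\<in>{0<..}. {z. w y \<le> fst z * y + snd z})"
      by (auto simp: affine_majorants_def)
    then show ?thesis
      by (auto intro!: closed_INT closed_Collect_le continuous_intros)
  qed
  then have "closed L"
    unfolding L_def by (intro closed_Int closed_Collect_le continuous_intros)
  moreover have "L \<subseteq> {0..K / x} \<times> {0..K}"
  proof
    fix z assume "z \<in> L"
    then obtain p q where z: "z = (p, q)" "(p, q) \<in> majorants" "p * x + q \<le> K"
      by (cases z) (auto simp: L_def)
    have "0 \<le> p" "0 \<le> q" "0 \<le> p * x"
      using majorants_nonneg[OF z(2)] assms by auto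
    then have "p * x \<le> K" "q \<le> K"
      using z(3) by linarith+
    then show "z \<in> {0..K / x} \<times> {0..K}"
      using z(1) \<open>0 \<le> p\<close> \<open>0 \<le> q\<close> assms by (auto simp: pos_le_divide_eq)
  qed
  then have "L = L \<inter> ({0..K / x} \<times> {0..K})"
    by blast
  ultimately have "compact L"
    by (metis closed_Int_compact compact_Times compact_Icc)
  moreover have "(p0, q0) \<in> L"
    using pq0 by (simp add: L_def K_def)
  ultimately have "\<exists>z\<in>L. \<forall>z'\<in>L. fst z * x + snd z \<le> fst z' * x + snd z'"
    by (intro continuous_attains_inf continuous_intros) auto
  then obtain z where z: "z \<in> L" "\<forall>z'\<in>L. fst z * x + snd z \<le> fst z' * x + snd z'"
    by blast
  have "supporting_line w x (fst z) (snd z)"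
    unfolding supporting_line_def
  proof safe
    show "(fst z, snd z) \<in> majorants"
      using z(1) by (simp add: L_def)
    fix p q assume "(p, q) \<in> majorants"
    then show "fst z * x + snd z \<le> p * x + q"
      using z by (cases "p * x + q \<le> K") (auto simp: L_def dest: bspec[where x = "(p, q)"])
  qed
  then show thesis
    by (rule that)
qed

text \<open>A pointwise strict inequality becomes a uniform gap that extends beyond
  \<open>x\<close>: near \<open>0\<close> the gap is almost \<open>q > 0\<close>, on the compact
  rest upper semicontinuity gives a maximum of the difference, and openness of sublevel sets carries
  the gap past \<open>x\<close>.\<close>

lemma majorant_gap:
  assumes "0 < x" "0 < q" and less: "\<And>y. 0 < y \<Longrightarrow> y \<le> x \<Longrightarrow> w y < p * y + q"
  obtains d x' where "0 < d" "x < x'" "\<And>y. 0 < y \<Longrightarrow> y \<le> x' \<Longrightarrow> w y + d \<le> p * y + q"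
proof -
  define f where "f y = w y + - (p * y + q)" for y
  have usc_f: "usc_on {0<..} f"
    unfolding f_def by (intro usc_on_add_continuous usc continuous_intros)
  have "(f \<longlongrightarrow> 0 + - (p * 0 + q)) (at_right 0)"
    unfolding f_def by (intro tendsto_intros zero)
  then have "eventually (\<lambda>y. f y < - q / 2) (at_right 0)"
    using \<open>0 < q\<close> by (intro order_tendstoD) auto
  then obtain s where s: "0 < s" "\<And>y. 0 < y \<Longrightarrow> y < s \<Longrightarrow> f y < - q / 2"
    unfolding eventually_at_right_field by auto
  \<comment> \<open>As \<open>s\<close> may exceed \<open>x\<close>, the \<open>min\<close> keeps
    the interval nonempty.\<close>
  have "{min s x..x} \<noteq> {}" "{min s x..x} \<subseteq> {0<..}"
    using s(1) \<open>0 < x\<close> by auto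
  then obtain m where m: "m \<in> {min s x..x}" "\<And>y. y \<in> {min s x..x} \<Longrightarrow> f y \<le> f m"
    using usc_on_attains_sup[OF usc_f compact_Icc] by meson
  have "f m < 0"
    using m(1) less[of m] s(1) \<open>0 < x\<close> by (auto simp: f_def min_le_iff_disj)
  have "openin (top_of_set {0<..}) {y \<in> {0<..}. f y < f m / 2}"
    using usc_f unfolding usc_on_def by blast
  then have "open {y \<in> {0<..}. f y < f m / 2}"
    using open_greaterThan openin_open_trans by blast
  moreover have "x \<in> {y \<in> {0<..}. f y < f m / 2}"
    using m(2)[of x] \<open>f m < 0\<close> \<open>0 < x\<close> by auto
  ultimately obtain e where e: "0 < e" "ball x e \<subseteq> {y \<in> {0<..}. f y < f m / 2}"
    by (meson open_contains_ball)
  \<comment> \<open>\<open>q / 2\<close> is the gap on \<open>(0, s)\<close>; halving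
    \<open>- f m\<close> leaves the room used just to the right of \<open>x\<close>.\<close>
  define d where "d = min (q / 2) (- f m / 2)"
  show thesis
  proof (rule that[of d "x + e / 2"])
    show "0 < d" "x < x + e / 2"
      using \<open>f m < 0\<close> \<open>0 < q\<close> e by (auto simp: d_def)
    fix y assume y: "0 < y" "y \<le> x + e / 2"
    consider "y < s" | "y \<in> {min s x..x}" | "x < y"
      by fastforce
    then have "f y \<le> - d"
    proof cases
      case 1
      then show ?thesis using s(2)[of y] y by (auto simp: d_def)
    next
      case 2
      then show ?thesis using m(2)[of y] \<open>f m < 0\<close> by (auto simp: d_def)
    next
      case 3
      then have "y \<in> ball x e" using y e(1) by (auto simp: dist_real_def)
      then show ?thesis using e(2) by (auto simp: d_def)
    qed
    then show "w y + d \<le> p * y + q"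
      by (simp add: f_def)
  qed
qed

section \<open>Contact points of a minimal line on either side of \<open>x\<close>\<close>

text \<open>Otherwise the line could be rotated about a point slightly to the right of \<open>x\<close>, which lowers
  its value at \<open>x\<close>.\<close>

lemma contact_left:
  assumes sl: "supporting_line w x p q" and "0 < x"
  shows "q = 0 \<or> (\<exists>k. 0 < k \<and> k \<le> x \<and> w k = p * k + q)"
proof (rule ccontr)
  assume neg: "\<not> ?thesis"
  have pq: "(p, q) \<in> majorants"
    using sl by (simp add: supporting_line_def)
  have "0 < q"
    using neg majorants_nonneg(2)[OF pq] by auto
  have "w y < p * y + q" if "0 < y" "y \<le> x" for y
    using neg that supporting_lineD(1)[OF sl, of y] by (auto simp: less_le)
  then obtain d x' where d: "0 < d" "x < x'" "\<And>y. 0 < y \<Longrightarrow> y \<le> x' \<Longrightarrow> w y + d \<le> p * y + q"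
    using majorant_gap[OF \<open>0 < x\<close> \<open>0 < q\<close>] by metis
  \<comment> \<open>The rotated line agrees with the old one at \<open>x'\<close>. To the left it
    drops by at most \<open>d\<close>, which the gap permits; to the right it rises.\<close>
  have "w y \<le> (p + d / x') * y + (q - d)" if "0 < y" for y
  proof (cases "y \<le> x'")
    case True
    have "0 \<le> d / x' * y"
      using d \<open>0 < x\<close> that by auto
    then show ?thesis
      using d(3)[OF that True] by (simp add: algebra_simps)
  next
    case False
    then have "d \<le> d / x' * y"
      using d(1,2) \<open>0 < x\<close> by (simp add: field_simps)
    then show ?thesis
      using supporting_lineD(1)[OF sl that] by (simp add: algebra_simps)
  qed
  then have "(p + d / x', q - d) \<in> majorants"
    by (auto simp: affine_majorants_def)
  then have "p * x + q \<le> (p + d / x') * x + (q - d)"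
    by (rule supporting_lineD(2)[OF sl])
  moreover have "d / x' * x < d"
    using d \<open>0 < x\<close> by (simp add: field_simps)
  ultimately show False
    by (simp add: algebra_simps)
qed

text \<open>Inversion \<open>y \<mapsto> 1 / y\<close> interchanges the two ends, and the factor
  \<open>y\<close> interchanges the two limit conditions.\<close>

lemma sublinear_gain_reflect: "sublinear_gain (\<lambda>y. y * w (1 / y))"
proof
  have "usc_on {0<..} (\<lambda>y. w (1 / y) * y)"
    by (intro usc_on_mult_continuous usc_on_compose[OF usc] continuous_intros) auto
  then show "usc_on {0<..} (\<lambda>y. y * w (1 / y))"
    by (simp add: mult.commute)
  have "((\<lambda>y. w (inverse y) / inverse y) \<longlongrightarrow> 0) (at_right 0)"
    by (rule filterlim_compose[OF infinity filterlim_inverse_at_top_right])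
  then show "((\<lambda>y. y * w (1 / y)) \<longlongrightarrow> 0) (at_right 0)"
    by (simp add: field_simps)
  have "((\<lambda>y. w (inverse y)) \<longlongrightarrow> 0) at_top"
    by (rule filterlim_compose[OF zero filterlim_inverse_at_right_top])
  then show "((\<lambda>y. y * w (1 / y) / y) \<longlongrightarrow> 0) at_top"
    by (rule Lim_transform_eventually)
      (use eventually_gt_at_top[of 0] in \<open>eventually_elim, simp add: field_simps\<close>)
qed

text \<open>Under the inversion slope and intercept swap roles and points right of \<open>x\<close>
  become points left of \<open>1 / x\<close>, so \<open>contact_left\<close> applies to the
  reflected gain.\<close>

lemma contact_right:
  assumes sl: "supporting_line w x p q" and "0 < x"
  shows "p = 0 \<or> (\<exists>k\<ge>x. w k = p * k + q)"
proof -
  interpret refl: sublinear_gain "\<lambda>y. y * w (1 / y)"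
    by (rule sublinear_gain_reflect)
  have maj: "(p', q') \<in> refl.majorants \<longleftrightarrow> (q', p') \<in> majorants" for p' q'
  proof
    assume *: "(p', q') \<in> refl.majorants"
    have "w y \<le> q' * y + p'" if "0 < y" for y
    proof -
      have "1 / y * w (1 / (1 / y)) \<le> p' * (1 / y) + q'"
        using * that unfolding affine_majorants_def by (auto dest: bspec[where x = "1 / y"])
      then have "y * (1 / y * w (1 / (1 / y))) \<le> y * (p' * (1 / y) + q')"
        using that by (intro mult_left_mono) auto
      then show ?thesis
        using that by (simp add: algebra_simps)
    qed
    then show "(q', p') \<in> majorants"
      by (auto simp: affine_majorants_def)
  next
    assume *: "(q', p') \<in> majorants"
    have "y * w (1 / y) \<le> p' * y + q'" if "0 < y" for y
    proof -
      have "w (1 / y) \<le> q' * (1 / y) + p'"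
        using * that unfolding affine_majorants_def by (auto dest: bspec[where x = "1 / y"])
      then show ?thesis
        using that by (simp add: field_simps)
    qed
    then show "(p', q') \<in> refl.majorants"
      by (auto simp: affine_majorants_def)
  qed
  have "supporting_line (\<lambda>y. y * w (1 / y)) (1 / x) q p"
    unfolding supporting_line_def
  proof safe
    show "(q, p) \<in> refl.majorants"
      using sl by (simp add: maj supporting_line_def)
    fix p' q' assume "(p', q') \<in> refl.majorants"
    then have "p * x + q \<le> q' * x + p'"
      using supporting_lineD(2)[OF sl] maj by blast
    then have "(p * x + q) / x \<le> (q' * x + p') / x"
      using \<open>0 < x\<close> by (intro divide_right_mono) auto
    then show "q * (1 / x) + p \<le> p' * (1 / x) + q'"
      using \<open>0 < x\<close> by (simp add: add_divide_distrib)
  qed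
  from refl.contact_left[OF this] \<open>0 < x\<close>
  consider "p = 0" | k where "0 < k" "k \<le> 1 / x" "k * w (1 / k) = q * k + p"
    by auto
  then show ?thesis
  proof cases
    case 2
    then have "x \<le> 1 / k" "w (1 / k) = p * (1 / k) + q"
      using \<open>0 < x\<close> by (auto simp: field_simps)
    then show ?thesis
      by blast
  qed simp
qed

text \<open>Between a contact point of its line and \<open>x\<close> the biconjugate is affine, because it is concave
  and dominated by the line. The ends \<open>0\<close> and \<open>\<infinity>\<close> count as contact points when \<open>q = 0\<close>
  and \<open>p = 0\<close>, respectively.\<close>

lemma contact_of_biconj_left:
  assumes sl: "supporting_line w x p q" and c: "0 < c" "c \<le> x"
    and biconj: "ereal (w c) = concave_biconj {0<..} w c"
    and end_point: "q = 0 \<or> (\<exists>k. 0 < k \<and> k \<le> c \<and> w k = p * k + q)"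
  shows "w c = p * c + q"
proof -
  \<comment> \<open>A majorant is above the line at some \<open>k \<le> c\<close> and at
    \<open>x \<ge> c\<close>; both being affine, it is above the line at \<open>c\<close>
    too.\<close>
  have "p * c + q \<le> p' * c + q'" if *: "(p', q') \<in> majorants" for p' q'
  proof -
    have at_x: "p * x + q \<le> p' * x + q'"
      by (rule supporting_lineD(2)[OF sl that])
    \<comment> \<open>For \<open>q = 0\<close> the comparison point is \<open>0\<close>, where the
      majorant has the value \<open>q' \<ge> 0\<close>.\<close>
    obtain k where k: "0 \<le> k" "k \<le> c" "p * k + q \<le> p' * k + q'"
    proof (cases "q = 0")
      case True
      then show ?thesis
        using that[of 0] majorants_nonneg[OF *] c by auto
    next
      case False
      then obtain k where "0 < k" "k \<le> c" "w k = p * k + q"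
        using end_point by auto
      then show ?thesis
        using that[of k] * by (force simp: affine_majorants_def)
    qed
    show ?thesis
    proof (rule ccontr)
      assume neg: "\<not> ?thesis"
      then have "(p' - p) * (c - k) < 0" "0 < (p' - p) * (x - c)"
        using at_x k by (auto simp: algebra_simps)
      then show False
        using k c by (auto simp: zero_less_mult_iff mult_less_0_iff)
    qed
  qed
  then have "ereal (p * c + q) \<le> concave_biconj {0<..} w c"
    by (auto simp: concave_biconj_eq_INF_affine intro!: INF_greatest)
  then have "p * c + q \<le> w c"
    by (simp only: biconj[symmetric] ereal_less_eq)
  with supporting_lineD(1)[OF sl c(1)] show ?thesis
    by simp
qed

lemma contact_of_biconj_right:
  assumes sl: "supporting_line w x p q" and c: "0 < x" "x \<le> c"
    and biconj: "ereal (w c) = concave_biconj {0<..} w c"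
    and end_point: "p = 0 \<or> (\<exists>k\<ge>c. w k = p * k + q)"
  shows "w c = p * c + q"
proof -
  have "p * c + q \<le> p' * c + q'" if *: "(p', q') \<in> majorants" for p' q'
  proof -
    have at_x: "p * x + q \<le> p' * x + q'"
      by (rule supporting_lineD(2)[OF sl that])
    show ?thesis
    proof (cases "p = 0")
      case True
      \<comment> \<open>The line is constant and the majorant has slope \<open>p' \<ge> 0\<close>,
        so the comparison at \<open>x\<close> persists at \<open>c\<close>.\<close>
      have "p' * x \<le> p' * c"
        using majorants_nonneg(1)[OF *] c by (simp add: mult_left_mono)
      then show ?thesis
        using at_x True by simp
    next
      case False
      then obtain k where k: "c \<le> k" "w k = p * k + q"
        using end_point by auto
      have at_k: "p * k + q \<le> p' * k + q'"
        using * k c unfolding affine_majorants_def by (auto simp: k(2)[symmetric])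
      show ?thesis
      proof (rule ccontr)
        assume neg: "\<not> ?thesis"
        then have "0 < (p' - p) * (k - c)" "(p' - p) * (c - x) < 0"
          using at_x at_k by (auto simp: algebra_simps)
        then show False
          using k c by (auto simp: zero_less_mult_iff mult_less_0_iff)
      qed
    qed
  qed
  then have "ereal (p * c + q) \<le> concave_biconj {0<..} w c"
    by (auto simp: concave_biconj_eq_INF_affine intro!: INF_greatest)
  then have "p * c + q \<le> w c"
    by (simp only: biconj[symmetric] ereal_less_eq)
  with supporting_lineD(1)[OF sl, of c] c show ?thesis
    by simp
qed

end

section \<open>Discounting and hitting times\<close>

text \<open>The case split is essential: \<open>enn2real\<close> maps infinity to \<open>0\<close>,
  which would otherwise yield the factor \<open>1\<close>. Values in \<open>ennreal\<close> avoid
  integrability conditions.\<close>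

definition discount :: "real \<Rightarrow> ennreal \<Rightarrow> ennreal" where
  "discount r T = (if T = \<infinity> then 0 else ennreal (exp (- r * enn2real T)))"

lemma discount_infinity [simp]: "discount r \<infinity> = 0" "discount r \<top> = 0"
  by (simp_all add: discount_def)

lemma discount_add: "discount r (s + t) = discount r s * discount r t"
  by (cases s; cases t)
    (simp_all add: discount_def ennreal_mult'[symmetric] exp_add[symmetric] algebra_simps
      flip: ennreal_plus)

lemma discount_antimono:
  assumes "0 < r" "s \<le> t"
  shows "discount r t \<le> discount r s"
  using assms by (cases s; cases t) (auto simp: discount_def top_unique intro!: ennreal_leI)

lemma measurable_discount [measurable]: "discount r \<in> borel_measurable borel"
  unfolding discount_def by measurable

section \<open>Hitting times of continuous paths\<close>

lemma hitting_time_le: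
  "0 \<le> t \<Longrightarrow> ereal (X t \<omega>) = y \<Longrightarrow> hitting_time X y \<omega> \<le> ennreal t"
  unfolding hitting_time_def by (intro Inf_lower) auto

lemma hitting_time_eq_infinity:
  "(\<And>t. 0 \<le> t \<Longrightarrow> ereal (X t \<omega>) \<noteq> y) \<Longrightarrow> hitting_time X y \<omega> = \<infinity>"
proof -
  assume "\<And>t. 0 \<le> t \<Longrightarrow> ereal (X t \<omega>) \<noteq> y"
  then have "{t. 0 \<le> t \<and> ereal (X t \<omega>) = y} = {}"
    by auto
  then show ?thesis
    unfolding hitting_time_def by simp
qed

text \<open>By continuity the times spent at \<open>y\<close> form a closed set, which contains its
  infimum.\<close>

lemma hitting_time_attained:
  assumes cont: "continuous_on {0..} (\<lambda>t. X t \<omega>)" and fin: "hitting_time X (ereal y) \<omega> < \<infinity>"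
  obtains t where "0 \<le> t" "hitting_time X (ereal y) \<omega> = ennreal t" "X t \<omega> = y"
proof -
  define S where "S = {t \<in> {0..}. X t \<omega> = y}"
  have T: "hitting_time X (ereal y) \<omega> = Inf (ennreal ` S)"
    unfolding hitting_time_def S_def by simp
  have "S \<noteq> {}"
    using fin T by auto
  moreover have "closed S"
    unfolding S_def using continuous_closed_preimage_constant[OF cont] by simp
  moreover have "bdd_below S"
    unfolding S_def by (rule bdd_belowI[of _ 0]) auto
  ultimately have "Inf S \<in> S" and lower: "\<And>t. t \<in> S \<Longrightarrow> Inf S \<le> t"
    by (auto intro: closed_contains_Inf cInf_lower)
  moreover have "Inf (ennreal ` S) = ennreal (Inf S)"
    using \<open>Inf S \<in> S\<close> lower by (intro antisym Inf_lower Inf_greatest) (auto intro: ennreal_leI)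
  ultimately show thesis
    using that[of "Inf S"] T by (auto simp: S_def)
qed

lemma hitting_time_le_iff:
  assumes "continuous_on {0..} (\<lambda>t. X t \<omega>)" and "0 \<le> t"
  shows "hitting_time X (ereal y) \<omega> \<le> ennreal t \<longleftrightarrow> (\<exists>s\<in>{0..t}. X s \<omega> = y)"
proof
  assume le: "hitting_time X (ereal y) \<omega> \<le> ennreal t"
  then have "hitting_time X (ereal y) \<omega> < \<infinity>"
    by (simp add: le_less_trans)
  with assms obtain s where "0 \<le> s" "hitting_time X (ereal y) \<omega> = ennreal s" "X s \<omega> = y"
    by (rule_tac hitting_time_attained)
  then show "\<exists>s\<in>{0..t}. X s \<omega> = y"
    using le assms by (auto simp: ennreal_le_iff)
next
  assume "\<exists>s\<in>{0..t}. X s \<omega> = y"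
  then obtain s where "0 \<le> s" "s \<le> t" "X s \<omega> = y"
    by auto
  then show "hitting_time X (ereal y) \<omega> \<le> ennreal t"
    using hitting_time_le[of s X \<omega> "ereal y"] ennreal_leI[of s t] by (auto intro: order_trans)
qed

text \<open>A visit after time \<open>s\<close> is a visit of the whole path; if
  \<open>s \<le> T\<close>, the first visit is itself a visit after \<open>s\<close>. The inequality
  will give superharmonicity and the equality harmonicity.\<close>

lemma hitting_time_shift:
  fixes X :: "real \<Rightarrow> 'w \<Rightarrow> real" and y s :: real
  assumes cont: "continuous_on {0..} (\<lambda>t. X t \<omega>)" and "0 \<le> s"
  defines "T \<equiv> hitting_time X (ereal y) \<omega>"
    and "T' \<equiv> hitting_time (\<lambda>t. X (s + t)) (ereal y) \<omega>"
  shows "T \<le> ennreal s + T'" and "ennreal s \<le> T \<Longrightarrow> ennreal s + T' = T"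
proof -
  have cont': "continuous_on {0..} (\<lambda>t. X (s + t) \<omega>)"
    using \<open>0 \<le> s\<close> by (intro continuous_on_compose2[OF cont] continuous_intros) auto
  show le: "T \<le> ennreal s + T'"
  proof (cases "T' < \<infinity>")
    case True
    then obtain t where t: "0 \<le> t" "T' = ennreal t" "X (s + t) \<omega> = y"
      unfolding T'_def using hitting_time_attained[of "\<lambda>t. X (s + t)" \<omega> y] cont' by blast
    then show ?thesis
      using hitting_time_le[of "s + t" X \<omega> "ereal y"] \<open>0 \<le> s\<close> by (simp add: T_def)
  next
    case False
    then show ?thesis
      by (simp add: less_top[symmetric])
  qed
  assume ge: "ennreal s \<le> T"
  have "ennreal s + T' \<le> T"
  proof (cases "T < \<infinity>")
    case True
    then obtain t where t: "0 \<le> t" "T = ennreal t" "X t \<omega> = y"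
      unfolding T_def using hitting_time_attained[of X \<omega> y] cont by blast
    then have "s \<le> t"
      using ge by (simp add: ennreal_le_iff)
    then have "T' \<le> ennreal (t - s)"
      unfolding T'_def using t by (intro hitting_time_le) auto
    then have "ennreal s + T' \<le> ennreal s + ennreal (t - s)"
      by (rule add_left_mono)
    then show ?thesis
      using \<open>s \<le> t\<close> \<open>0 \<le> s\<close> t by (simp flip: ennreal_plus)
  next
    case False
    then show ?thesis
      by (simp add: less_top[symmetric])
  qed
  with le show "ennreal s + T' = T"
    by (rule antisym[rotated])
qed

text \<open>Replaces an uncountable choice of times by countably many conditions. Conversely, the
  minimum of \<open>\<bar>w s - y\<bar>\<close> on \<open>{0..t}\<close> is attained, and the
  approximations force it to be zero.\<close>

lemma continuous_hits_iff_approximates: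
  fixes w :: "real \<Rightarrow> real"
  assumes cont: "continuous_on {0..} w" and "0 \<le> t"
  shows "(\<exists>s\<in>{0..t}. w s = y) \<longleftrightarrow> (\<forall>n. \<exists>s\<in>insert t (\<rat> \<inter> {0..t}). \<bar>w s - y\<bar> < 1 / real (Suc n))"
proof (intro iffI allI)
  fix n assume "\<exists>s\<in>{0..t}. w s = y"
  then obtain s where s: "0 \<le> s" "s \<le> t" "w s = y"
    by auto
  show "\<exists>s\<in>insert t (\<rat> \<inter> {0..t}). \<bar>w s - y\<bar> < 1 / real (Suc n)"
  \<comment> \<open>The approximating rationals are taken to the right of \<open>s\<close>; for
    \<open>s = t\<close> there is no room, and the added point \<open>t\<close> is used.\<close>
  proof (cases "s = t")
    case False
    obtain d where d: "0 < d" "\<And>u. u \<in> {0..} \<Longrightarrow> dist u s < d \<Longrightarrow> dist (w u) (w s) < 1 / real (Suc n)"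
      using cont[unfolded continuous_on_iff] s(1) by (metis atLeast_iff of_nat_0_less_iff zero_less_Suc zero_less_divide_1_iff)
    obtain u where u: "u \<in> \<rat>" "s < u" "u < min t (s + d)"
      using Rats_dense_in_real[of s "min t (s + d)"] s False d by auto
    then have "\<bar>w u - y\<bar> < 1 / real (Suc n)"
      using d(2)[of u] s by (auto simp: dist_real_def)
    then show ?thesis
      using u s by (intro bexI[of _ u]) auto
  qed (use s in auto)
next
  assume approx: "\<forall>n. \<exists>s\<in>insert t (\<rat> \<inter> {0..t}). \<bar>w s - y\<bar> < 1 / real (Suc n)"
  have "continuous_on {0..t} (\<lambda>s. \<bar>w s - y\<bar>)"
    by (intro continuous_intros continuous_on_subset[OF cont]) auto
  then obtain m where m: "m \<in> {0..t}" "\<And>s. s \<in> {0..t} \<Longrightarrow> \<bar>w m - y\<bar> \<le> \<bar>w s - y\<bar>"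
    using continuous_attains_inf[of "{0..t}" "\<lambda>s. \<bar>w s - y\<bar>"] \<open>0 \<le> t\<close> by auto
  have "\<bar>w m - y\<bar> \<le> 0"
  proof (rule ccontr)
    assume "\<not> ?thesis"
    then obtain n where n: "1 / real (Suc n) < \<bar>w m - y\<bar>"
      using reals_Archimedean[of "\<bar>w m - y\<bar>"] by (auto simp: inverse_eq_divide)
    obtain s where "s \<in> insert t (\<rat> \<inter> {0..t})" "\<bar>w s - y\<bar> < 1 / real (Suc n)"
      using approx by blast
    then show False
      using m(2)[of s] n \<open>0 \<le> t\<close> by auto
  qed
  then show "\<exists>s\<in>{0..t}. w s = y"
    using m(1) by auto
qed

text \<open>On continuous paths this is the hitting time of \<open>y\<close>. Unlike the latter it only refers to
  countably many coordinates and is therefore measurable with respect to the product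
  \<open>\<sigma>\<close>-algebra.\<close>

definition rational_hitting_time :: "real \<Rightarrow> (real \<Rightarrow> real) \<Rightarrow> ennreal" where
  "rational_hitting_time y w = (INF t\<in>{t \<in> \<rat>. 0 \<le> t}.
     if \<forall>n. \<exists>s\<in>insert t (\<rat> \<inter> {0..t}). \<bar>w s - y\<bar> < 1 / real (Suc n) then ennreal t else \<infinity>)"

lemma countable_nonneg_rats: "countable {t::real. t \<in> \<rat> \<and> 0 \<le> t}"
  using countable_rat by (rule countable_subset[rotated]) auto

lemma measurable_rational_hitting_time [measurable]:
  "rational_hitting_time y \<in> borel_measurable path_space"
proof -
  have meas: "(\<lambda>w. w s) \<in> borel_measurable path_space" if "0 \<le> s" for s
    unfolding path_space_def using that by (intro measurable_component_singleton) auto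
  have "Measurable.pred path_space (\<lambda>w. \<bar>w s - y\<bar> < 1 / real (Suc n))" if "0 \<le> s" for s n
    using meas[OF that] by measurable
  then have "Measurable.pred path_space
      (\<lambda>w. \<forall>n. \<exists>s\<in>insert t (\<rat> \<inter> {0..t}). \<bar>w s - y\<bar> < 1 / real (Suc n))" if "0 \<le> t" for t
    using that countable_rat by (intro pred_intros_countable(1) measurable_pred_countable(2)) auto
  then show ?thesis
    unfolding rational_hitting_time_def
    by (intro borel_measurable_INF countable_nonneg_rats measurable_If) auto
qed

text \<open>The condition under the infimum says that \<open>y\<close> is hit by time
  \<open>t\<close>, so the infimum runs over the rationals not before the hitting time and equals it
  by density. Agreement at nonnegative times suffices because \<open>path_after\<close> is
  restricted to them.\<close>

lemma rational_hitting_time_eq: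
  assumes cont: "continuous_on {0..} (\<lambda>t. X t \<omega>)" and eq: "\<And>t. 0 \<le> t \<Longrightarrow> w t = X t \<omega>"
  shows "rational_hitting_time y w = hitting_time X (ereal y) \<omega>"
proof -
  let ?T = "hitting_time X (ereal y) \<omega>"
  have iff: "(\<forall>n. \<exists>s\<in>insert t (\<rat> \<inter> {0..t}). \<bar>w s - y\<bar> < 1 / real (Suc n)) \<longleftrightarrow> ?T \<le> ennreal t"
    if "0 \<le> t" for t
  proof -
    have "continuous_on {0..} w"
      by (rule continuous_on_cong[THEN iffD1, OF refl _ cont]) (simp add: eq)
    then show ?thesis
      using that eq unfolding hitting_time_le_iff[where X = X and \<omega> = \<omega>, OF cont that]
      by (subst continuous_hits_iff_approximates[symmetric]) auto
  qed
  have "rational_hitting_time y w =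
      (INF t\<in>{t \<in> \<rat>. 0 \<le> t}. if ?T \<le> ennreal t then ennreal t else \<infinity>)"
    unfolding rational_hitting_time_def using iff by (intro INF_cong) auto
  also have "\<dots> = ?T"
  proof (rule antisym)
    show "?T \<le> (INF t\<in>{t \<in> \<rat>. 0 \<le> t}. if ?T \<le> ennreal t then ennreal t else \<infinity>)"
      by (intro INF_greatest) auto
    show "(INF t\<in>{t \<in> \<rat>. 0 \<le> t}. if ?T \<le> ennreal t then ennreal t else \<infinity>) \<le> ?T"
    proof (rule dense_ge)
      fix u assume "?T < u"
      then obtain t0 where t0: "0 \<le> t0" "?T = ennreal t0"
        by (cases ?T) auto
      obtain u' where u': "t0 < u'" "ennreal u' \<le> u"
      proof (cases u)
        case (real v)
        then show ?thesis
          using that[of v] \<open>?T < u\<close> t0 by (simp add: ennreal_less_iff)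
      next
        case top
        then show ?thesis
          using that[of "t0 + 1"] by simp
      qed
      obtain t where t: "t \<in> \<rat>" "t0 < t" "t < u'"
        using Rats_dense_in_real[OF u'(1)] by auto
      have "(INF t\<in>{t \<in> \<rat>. 0 \<le> t}. if ?T \<le> ennreal t then ennreal t else \<infinity>) \<le> ennreal t"
        using t t0 by (intro INF_lower2[of t]) (auto simp: ennreal_leI)
      also have "\<dots> \<le> u"
        using t u' by (meson ennreal_leI less_imp_le order_trans)
      finally show "(INF t\<in>{t \<in> \<rat>. 0 \<le> t}. if ?T \<le> ennreal t then ennreal t else \<infinity>) \<le> u" .
    qed
  qed
  finally show ?thesis .
qed

section \<open>The strong Markov property for functionals\<close>

context diffusion
begin

abbreviation "states \<equiv> einterval a b"

lemma measurable_X: "0 \<le> t \<Longrightarrow> X t \<in> borel_measurable M"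
  using measurable_from_subalg[OF _ adapted[of t]] sets_Fil space_F
  by (auto simp: subalgebra_def)

lemma space_P: "x \<in> states \<Longrightarrow> space (P x) = space M"
  using sets_P by (rule sets_eq_imp_space_eq)

lemma measurable_P: "x \<in> states \<Longrightarrow> f \<in> measurable M N \<Longrightarrow> f \<in> measurable (P x) N"
  using measurable_cong_sets[OF sets_P refl] by blast

text \<open>Rounding \<open>\<sigma>\<close> up to multiples of \<open>1 / Suc n\<close> leaves
  countably many times; path continuity gives the limit.\<close>

lemma measurable_X_random_time:
  assumes \<sigma>: "\<sigma> \<in> borel_measurable M" and nonneg: "\<And>\<omega>. \<omega> \<in> space M \<Longrightarrow> 0 \<le> \<sigma> \<omega>"
  shows "(\<lambda>\<omega>. X (\<sigma> \<omega>) \<omega>) \<in> borel_measurable M"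
proof -
  define k where "k n \<omega> = nat \<lceil>\<sigma> \<omega> * real (Suc n)\<rceil>" for n \<omega>
  have meas: "(\<lambda>\<omega>. X (real (k n \<omega>) / real (Suc n)) \<omega>) \<in> borel_measurable M" for n
  proof (rule measurable_compose_countable[where f = "\<lambda>i \<omega>. X (real i / real (Suc n)) \<omega>" and g = "k n"])
    show "(\<lambda>\<omega>. X (real i / real (Suc n)) \<omega>) \<in> borel_measurable M" for i
      by (rule measurable_X) simp
    show "k n \<in> measurable M (count_space UNIV)"
      unfolding k_def using \<sigma> by measurable
  qed
  have lim: "(\<lambda>n. X (real (k n \<omega>) / real (Suc n)) \<omega>) \<longlonglongrightarrow> X (\<sigma> \<omega>) \<omega>" if \<omega>: "\<omega> \<in> space M" for \<omega>
  proof -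
    have "(\<lambda>n. real (k n \<omega>) / real (Suc n)) \<longlonglongrightarrow> \<sigma> \<omega>"
    proof (rule tendsto_sandwich[OF always_eventually always_eventually])
      show "\<forall>n. \<sigma> \<omega> \<le> real (k n \<omega>) / real (Suc n)"
      proof
        fix n
        have "\<sigma> \<omega> * real (Suc n) \<le> real (k n \<omega>)"
          unfolding k_def by linarith
        then show "\<sigma> \<omega> \<le> real (k n \<omega>) / real (Suc n)"
          by (simp add: field_simps)
      qed
      show "\<forall>n. real (k n \<omega>) / real (Suc n) \<le> \<sigma> \<omega> + 1 / real (Suc n)"
      proof
        fix n
        have "0 \<le> \<sigma> \<omega> * real (Suc n)"
          using nonneg[OF \<omega>] by simp
        then have "real (k n \<omega>) \<le> \<sigma> \<omega> * real (Suc n) + 1"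
          unfolding k_def by linarith
        then have "real (k n \<omega>) / real (Suc n) \<le> (\<sigma> \<omega> * real (Suc n) + 1) / real (Suc n)"
          by (rule divide_right_mono) simp
        then show "real (k n \<omega>) / real (Suc n) \<le> \<sigma> \<omega> + 1 / real (Suc n)"
          by (simp only: add_divide_distrib) simp
      qed
      show "(\<lambda>n. \<sigma> \<omega> + 1 / real (Suc n)) \<longlonglongrightarrow> \<sigma> \<omega>"
        using tendsto_add[OF tendsto_const LIMSEQ_inverse_real_of_nat, of "\<sigma> \<omega>"]
        by (simp add: inverse_eq_divide)
    qed simp
    then show ?thesis
      using nonneg[OF \<omega>] by (intro continuous_on_tendsto_compose[OF continuous_paths[OF \<omega>]]) auto
  qed
  show ?thesis
    by (rule borel_measurable_LIMSEQ_real[OF lim meas])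
qed

lemma measurable_stopping:
  assumes "stopping_time Fil \<tau>"
  shows "\<tau> \<in> borel_measurable M"
proof (rule borel_measurableI_le)
  fix t
  show "{\<omega> \<in> space M. \<tau> \<omega> \<le> t} \<in> sets M"
  proof (cases t)
    case (real u)
    then show ?thesis
      using stopping_timeD[OF assms, of t] sets_Fil[of u] by (auto simp: pred_def space_F)
  qed simp
qed

lemma measurable_X_stopping:
  assumes "stopping_time Fil \<tau>"
  shows "(\<lambda>\<omega>. X (enn2real (\<tau> \<omega>)) \<omega>) \<in> borel_measurable M"
  using measurable_stopping[OF assms] by (intro measurable_X_random_time) auto

lemma measurable_path_after:
  assumes "\<sigma> \<in> borel_measurable M" and "\<And>\<omega>. \<omega> \<in> space M \<Longrightarrow> 0 \<le> \<sigma> \<omega>"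
  shows "(\<lambda>\<omega>. path_after X (\<sigma> \<omega>) \<omega>) \<in> measurable M path_space"
  unfolding path_after_def path_space_def
  using assms by (intro measurable_restrict measurable_X_random_time) auto

lemma measurable_path_law_stopping:
  assumes "stopping_time Fil \<tau>"
  shows "(\<lambda>\<omega>. path_law P X (X (enn2real (\<tau> \<omega>)) \<omega>)) \<in> measurable M (prob_algebra path_space)"
  using state_space
  by (intro measurable_compose[OF measurable_restrict_space2 path_law_kernel] measurable_X_stopping assms)
    auto

lemma continuous_path_after:
  "\<omega> \<in> space M \<Longrightarrow> 0 \<le> s \<Longrightarrow> continuous_on {0..} (\<lambda>t. X (s + t) \<omega>)"
  by (intro continuous_on_compose2[OF continuous_paths] continuous_intros) auto

lemma nn_integral_path_law:
  assumes "x \<in> states" and "f \<in> borel_measurable path_space"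
  shows "(\<integral>\<^sup>+ w. f w \<partial>path_law P X x) = (\<integral>\<^sup>+ \<omega>. f (path_after X 0 \<omega>) \<partial>P x)"
  unfolding path_law_def using assms
  by (intro nn_integral_distr measurable_P measurable_path_after) auto

text \<open>The axiom speaks of events only. It is extended first from path events \<open>B\<close>
  to \<open>f\<close>, for fixed \<open>A\<close>, and then from events \<open>A\<close> generated
  by \<open>\<tau>\<close> to \<open>g (\<tau> \<omega>)\<close>; the value
  \<open>g \<infinity> = 0\<close> removes infinite times.\<close>

lemma strong_Markov_nn_integral:
  assumes x: "x \<in> states" and \<tau>: "stopping_time Fil \<tau>" and f [measurable]: "f \<in> borel_measurable path_space"
    and g [measurable]: "g \<in> borel_measurable borel" and g_infinity: "g \<infinity> = 0"
  shows "(\<integral>\<^sup>+ \<omega>. g (\<tau> \<omega>) * f (path_after X (enn2real (\<tau> \<omega>)) \<omega>) \<partial>P x) =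
    (\<integral>\<^sup>+ \<omega>. g (\<tau> \<omega>) * (\<integral>\<^sup>+ w. f w \<partial>path_law P X (X (enn2real (\<tau> \<omega>)) \<omega>)) \<partial>P x)"
proof -
  interpret prob_space "P x"
    by (rule prob_space_P[OF x])
  note [measurable_cong] = sets_P[OF x]
  define \<theta> where "\<theta> \<omega> = path_after X (enn2real (\<tau> \<omega>)) \<omega>" for \<omega>
  define K where "K \<omega> = path_law P X (X (enn2real (\<tau> \<omega>)) \<omega>)" for \<omega>
  have [measurable]: "\<tau> \<in> borel_measurable M"
    by (rule measurable_stopping[OF \<tau>])
  have \<theta> [measurable]: "\<theta> \<in> measurable M path_space"
    unfolding \<theta>_def by (intro measurable_path_after) auto
  have K [measurable]: "K \<in> measurable M (subprob_algebra path_space)"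
    unfolding K_def by (intro measurable_prob_algebraD measurable_path_law_stopping \<tau>)
  \<comment> \<open>\<open>pre_sigma \<tau>\<close> itself need not be contained in \<open>M\<close>, because \<open>sets_Fil\<close> says nothing
    about \<open>Fil \<infinity>\<close>.\<close>
  define V where "V = vimage_algebra (space M) \<tau> borel"
  have V_pre_sigma: "sets V \<subseteq> sets (pre_sigma \<tau>)" and sub: "sets V \<subseteq> sets M"
    using measurable_sets[OF measurable_stopping_time_pre_sigma[OF \<tau>]]
      measurable_sets[OF measurable_stopping[OF \<tau>]]
    by (auto simp: V_def sets_vimage_algebra2 space_pre_sigma)
  have on_events: "(\<integral>\<^sup>+ \<omega>. f (\<theta> \<omega>) * indicator {\<omega> \<in> A. \<tau> \<omega> < \<infinity>} \<omega> \<partial>P x) =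
      (\<integral>\<^sup>+ \<omega>. (\<integral>\<^sup>+ w. f w \<partial>K \<omega>) * indicator {\<omega> \<in> A. \<tau> \<omega> < \<infinity>} \<omega> \<partial>P x)"
    if "A \<in> sets V" for A
  proof -
    have A: "A \<in> sets (pre_sigma \<tau>)" and [measurable]: "A \<in> sets M"
      using that V_pre_sigma sub by auto
    define A' where "A' = {\<omega> \<in> A. \<tau> \<omega> < \<infinity>}"
    have "A' = A \<inter> {\<omega> \<in> space M. \<tau> \<omega> < \<infinity>}"
      using sets.sets_into_space[OF \<open>A \<in> sets M\<close>] by (auto simp: A'_def)
    then have A' [measurable]: "A' \<in> sets M"
      by simp
    define Q where "Q = density (P x) (indicator A')"
    have Q [measurable_cong]: "sets Q = sets M" and space_Q: "space Q = space M"
      by (simp_all add: Q_def sets_P[OF x] space_P[OF x])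
    \<comment> \<open>Under \<open>P x\<close> restricted to \<open>A'\<close> the shifted path is
      distributed as a mixture of path laws; on each \<open>B\<close> this is the axiom.\<close>
    have "distr Q path_space \<theta> = Q \<bind> K"
    proof (rule measure_eqI)
      show sets: "sets (distr Q path_space \<theta>) = sets (Q \<bind> K)"
        using not_empty by (subst sets_bind[where N = path_space]) (auto simp: space_Q space_P[OF x] sets_kernel[OF K])
      fix B assume "B \<in> sets (distr Q path_space \<theta>)"
      then have B [measurable]: "B \<in> sets path_space"
        by simp
      have "emeasure (distr Q path_space \<theta>) B = emeasure Q (\<theta> -` B \<inter> space M)"
        by (simp add: emeasure_distr space_Q)
      also have "\<dots> = emeasure (P x) (A' \<inter> (\<theta> -` B \<inter> space M))"
        unfolding Q_def by (subst emeasure_density) (auto simp flip: indicator_inter_arith simp: sets_P[OF x] intro!: nn_integral_indicator)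
      also have "A' \<inter> (\<theta> -` B \<inter> space M) = {\<omega> \<in> A. \<tau> \<omega> < \<infinity> \<and> path_after X (enn2real (\<tau> \<omega>)) \<omega> \<in> B}"
        using sets.sets_into_space[OF \<open>A \<in> sets M\<close>] by (auto simp: A'_def \<theta>_def)
      also have "emeasure (P x) \<dots> = (\<integral>\<^sup>+ \<omega>. emeasure (K \<omega>) B * indicator A' \<omega> \<partial>P x)"
        unfolding K_def A'_def by (rule strong_Markov[OF x \<tau> A B])
      also have "\<dots> = (\<integral>\<^sup>+ \<omega>. emeasure (K \<omega>) B \<partial>Q)"
        unfolding Q_def by (subst nn_integral_density) (auto simp: mult.commute)
      also have "\<dots> = emeasure (Q \<bind> K) B"
        using not_empty by (intro emeasure_bind[symmetric, where N = path_space]) (auto simp: space_Q space_P[OF x])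
      finally show "emeasure (distr Q path_space \<theta>) B = emeasure (Q \<bind> K) B" .
    qed
    then have "(\<integral>\<^sup>+ w. f w \<partial>distr Q path_space \<theta>) = (\<integral>\<^sup>+ w. f w \<partial>(Q \<bind> K))"
      by simp
    moreover have "(\<integral>\<^sup>+ w. f w \<partial>distr Q path_space \<theta>) = (\<integral>\<^sup>+ \<omega>. f (\<theta> \<omega>) \<partial>Q)"
      by (intro nn_integral_distr) auto
    moreover have "(\<integral>\<^sup>+ w. f w \<partial>(Q \<bind> K)) = (\<integral>\<^sup>+ \<omega>. (\<integral>\<^sup>+ w. f w \<partial>K \<omega>) \<partial>Q)"
      by (intro nn_integral_bind[where B = path_space]) auto
    moreover have "(\<integral>\<^sup>+ \<omega>. h \<omega> \<partial>Q) = (\<integral>\<^sup>+ \<omega>. h \<omega> * indicator A' \<omega> \<partial>P x)"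
      if "h \<in> borel_measurable M" for h
      unfolding Q_def using that measurable_P[OF x that] by (subst nn_integral_density) (auto simp: mult.commute)
    ultimately show ?thesis
      unfolding A'_def by simp
  qed
  \<comment> \<open>Both sides of \<open>on_events\<close> are values of measures
    \<open>N h\<close>. Agreement on \<open>V\<close> suffices, since
    \<open>g (\<tau> \<omega>)\<close> is measurable with respect to \<open>V\<close>.\<close>
  define N where "N h = density (P x) (\<lambda>\<omega>. h \<omega> * indicator {\<omega>. \<tau> \<omega> < \<infinity>} \<omega>)" for h :: "'w \<Rightarrow> ennreal"
  have subalg: "subalgebra (N h) V" for h
    using sub by (simp add: N_def subalgebra_def V_def sets_P[OF x] space_P[OF x])
  have int_N: "(\<integral>\<^sup>+ \<omega>. g (\<tau> \<omega>) \<partial>restr_to_subalg (N h) V) = (\<integral>\<^sup>+ \<omega>. g (\<tau> \<omega>) * h \<omega> \<partial>P x)"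
    if [measurable]: "h \<in> borel_measurable M" for h
  proof -
    have "\<tau> \<in> measurable V borel"
      unfolding V_def by (rule measurable_vimage_algebra1) simp
    then have "(\<integral>\<^sup>+ \<omega>. g (\<tau> \<omega>) \<partial>restr_to_subalg (N h) V) = (\<integral>\<^sup>+ \<omega>. g (\<tau> \<omega>) \<partial>N h)"
      by (intro nn_integral_subalgebra2[OF subalg] measurable_compose[OF _ g])
    also have "\<dots> = (\<integral>\<^sup>+ \<omega>. (h \<omega> * indicator {\<omega>. \<tau> \<omega> < \<infinity>} \<omega>) * g (\<tau> \<omega>) \<partial>P x)"
      unfolding N_def by (intro nn_integral_density) auto
    also have "\<dots> = (\<integral>\<^sup>+ \<omega>. g (\<tau> \<omega>) * h \<omega> \<partial>P x)"
      using g_infinity by (intro nn_integral_cong) (auto simp: mult.commute less_top[symmetric] split: split_indicator)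
    finally show ?thesis .
  qed
  have emeasure_N: "emeasure (N h) A = (\<integral>\<^sup>+ \<omega>. h \<omega> * indicator {\<omega> \<in> A. \<tau> \<omega> < \<infinity>} \<omega> \<partial>P x)"
    if [measurable]: "h \<in> borel_measurable M" and "A \<in> sets V" for h A
  proof -
    have "A \<in> sets (P x)"
      using that(2) sub sets_P[OF x] by blast
    then show ?thesis
      unfolding N_def
      by (subst emeasure_density) (auto intro!: nn_integral_cong split: split_indicator)
  qed
  have "restr_to_subalg (N (\<lambda>\<omega>. f (\<theta> \<omega>))) V = restr_to_subalg (N (\<lambda>\<omega>. \<integral>\<^sup>+ w. f w \<partial>K \<omega>)) V"
  proof (rule measure_eqI)
    fix A assume "A \<in> sets (restr_to_subalg (N (\<lambda>\<omega>. f (\<theta> \<omega>))) V)"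
    then have A: "A \<in> sets V"
      by (simp add: sets_restr_to_subalg[OF subalg])
    have "emeasure (N (\<lambda>\<omega>. f (\<theta> \<omega>))) A = emeasure (N (\<lambda>\<omega>. \<integral>\<^sup>+ w. f w \<partial>K \<omega>)) A"
      using on_events[OF A] by (subst (1 2) emeasure_N[OF _ A]) auto
    then show "emeasure (restr_to_subalg (N (\<lambda>\<omega>. f (\<theta> \<omega>))) V) A =
        emeasure (restr_to_subalg (N (\<lambda>\<omega>. \<integral>\<^sup>+ w. f w \<partial>K \<omega>)) V) A"
      by (simp add: emeasure_restr_to_subalg[OF subalg A])
  qed (simp add: sets_restr_to_subalg[OF subalg])
  moreover have "(\<lambda>\<omega>. f (\<theta> \<omega>)) \<in> borel_measurable M" "(\<lambda>\<omega>. \<integral>\<^sup>+ w. f w \<partial>K \<omega>) \<in> borel_measurable M"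
    by measurable
  ultimately show ?thesis
    using int_N[of "\<lambda>\<omega>. f (\<theta> \<omega>)"] int_N[of "\<lambda>\<omega>. \<integral>\<^sup>+ w. f w \<partial>K \<omega>"]
    by (simp add: \<theta>_def K_def)
qed

text \<open>Hitting a finite level by time \<open>u\<close> is a countable condition on the values
  of the process up to \<open>u\<close>; infinite levels are never hit.\<close>

lemma stopping_time_hitting_time: "stopping_time Fil (hitting_time X y)"
proof (cases y)
  case (real y')
  show ?thesis
    unfolding real
  proof (rule stopping_timeI)
    fix t
    show "Measurable.pred (Fil t) (\<lambda>\<omega>. hitting_time X (ereal y') \<omega> \<le> t)"
    proof (cases t)
      case (real u)
      have meas: "X s \<in> borel_measurable (Fil t)" if "0 \<le> s" "s \<le> u" for s
        using that real sets_F_mono[of "ennreal s" t]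
        by (intro measurable_from_subalg[OF _ adapted]) (auto simp: subalgebra_def space_F ennreal_leI)
      have "Measurable.pred (Fil t) (\<lambda>\<omega>. \<bar>X s \<omega> - y'\<bar> < 1 / real (Suc n))"
        if "0 \<le> s" "s \<le> u" for s n
        using meas[OF that] by measurable
      then have "Measurable.pred (Fil t)
          (\<lambda>\<omega>. \<forall>n. \<exists>s\<in>insert u (\<rat> \<inter> {0..u}). \<bar>X s \<omega> - y'\<bar> < 1 / real (Suc n))"
        using real countable_rat by (intro pred_intros_countable(1) measurable_pred_countable(2)) auto
      also have "?this \<longleftrightarrow> ?thesis"
        using real by (intro measurable_cong)
          (simp add: space_F hitting_time_le_iff[where X = X, OF continuous_paths]
            continuous_hits_iff_approximates[OF continuous_paths])
      finally show ?thesis .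
    qed simp
  qed
next
  case PInf
  then have "hitting_time X y = (\<lambda>_. \<infinity>)"
    by (intro ext hitting_time_eq_infinity) simp
  then show ?thesis
    by (simp add: stopping_time_const)
next
  case MInf
  then have "hitting_time X y = (\<lambda>_. \<infinity>)"
    by (intro ext hitting_time_eq_infinity) simp
  then show ?thesis
    by (simp add: stopping_time_const)
qed

end

section \<open>Superharmonicity of the fundamental solutions\<close>

lemma liminf_eventually_const:
  fixes f :: "nat \<Rightarrow> 'a::{complete_linorder, linorder_topology}"
  assumes "eventually (\<lambda>n. f n = l) sequentially"
  shows "liminf f = l"
  using assms by (intro lim_imp_Liminf tendsto_eventually) auto

context diffusion
begin

section \<open>The mean discount factor up to a hitting time\<close>

definition mean_discount :: "real \<Rightarrow> real \<Rightarrow> real \<Rightarrow> ennreal" where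
  "mean_discount r y z = (\<integral>\<^sup>+ \<omega>. discount r (hitting_time X (ereal y) \<omega>) \<partial>P z)"

text \<open>As the integral of one fixed path functional against the kernel it becomes accessible to
  the strong Markov property, and its measurability follows.\<close>

lemma mean_discount_eq_path_law:
  assumes "z \<in> states"
  shows "mean_discount r y z = (\<integral>\<^sup>+ w. discount r (rational_hitting_time y w) \<partial>path_law P X z)"
proof -
  have "(\<integral>\<^sup>+ w. discount r (rational_hitting_time y w) \<partial>path_law P X z) =
      (\<integral>\<^sup>+ \<omega>. discount r (rational_hitting_time y (path_after X 0 \<omega>)) \<partial>P z)"
    by (rule nn_integral_path_law[OF assms]) measurable
  also have "\<dots> = mean_discount r y z"
    unfolding mean_discount_def
    by (intro nn_integral_cong arg_cong[of _ _ "discount r"] rational_hitting_time_eq[OF continuous_paths])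
      (auto simp: space_P[OF assms] path_after_def)
  finally show ?thesis ..
qed

lemma measurable_mean_discount:
  assumes "stopping_time Fil \<tau>"
  shows "(\<lambda>\<omega>. mean_discount r y (X (enn2real (\<tau> \<omega>)) \<omega>)) \<in> borel_measurable M"
proof -
  have [measurable]: "(\<lambda>\<omega>. path_law P X (X (enn2real (\<tau> \<omega>)) \<omega>)) \<in> measurable M (subprob_algebra path_space)"
    by (intro measurable_prob_algebraD measurable_path_law_stopping assms)
  have "(\<lambda>\<omega>. \<integral>\<^sup>+ w. discount r (rational_hitting_time y w) \<partial>path_law P X (X (enn2real (\<tau> \<omega>)) \<omega>)) \<in> borel_measurable M"
    by measurable
  then show ?thesis
    by (subst measurable_cong[OF mean_discount_eq_path_law]) (auto intro: state_space)
qed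

text \<open>Restarting at \<open>\<tau>\<close> and multiplying the discounts yields the discount up
  to the first visit of \<open>y\<close> after \<open>\<tau>\<close>.\<close>

lemma mean_discount_stopping:
  assumes x: "x \<in> states" and \<tau>: "stopping_time Fil \<tau>"
  shows "(\<integral>\<^sup>+ \<omega>. discount r (\<tau> \<omega>) * mean_discount r y (X (enn2real (\<tau> \<omega>)) \<omega>) \<partial>P x) =
    (\<integral>\<^sup>+ \<omega>. discount r (\<tau> \<omega> + hitting_time (\<lambda>t. X (enn2real (\<tau> \<omega>) + t)) (ereal y) \<omega>) \<partial>P x)"
proof -
  have "(\<integral>\<^sup>+ \<omega>. discount r (\<tau> \<omega>) * mean_discount r y (X (enn2real (\<tau> \<omega>)) \<omega>) \<partial>P x) =
      (\<integral>\<^sup>+ \<omega>. discount r (\<tau> \<omega>) *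
        (\<integral>\<^sup>+ w. discount r (rational_hitting_time y w) \<partial>path_law P X (X (enn2real (\<tau> \<omega>)) \<omega>)) \<partial>P x)"
    by (intro nn_integral_cong) (simp add: mean_discount_eq_path_law state_space space_P[OF x])
  also have "\<dots> = (\<integral>\<^sup>+ \<omega>. discount r (\<tau> \<omega>) *
      discount r (rational_hitting_time y (path_after X (enn2real (\<tau> \<omega>)) \<omega>)) \<partial>P x)"
    by (rule strong_Markov_nn_integral[OF x \<tau>, symmetric]) auto
  also have "\<dots> =
      (\<integral>\<^sup>+ \<omega>. discount r (\<tau> \<omega> + hitting_time (\<lambda>t. X (enn2real (\<tau> \<omega>) + t)) (ereal y) \<omega>) \<partial>P x)"
  proof (rule nn_integral_cong)
    fix \<omega> assume "\<omega> \<in> space (P x)"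
    then have "rational_hitting_time y (path_after X (enn2real (\<tau> \<omega>)) \<omega>) =
        hitting_time (\<lambda>t. X (enn2real (\<tau> \<omega>) + t)) (ereal y) \<omega>"
      by (intro rational_hitting_time_eq continuous_path_after) (auto simp: space_P[OF x] path_after_def)
    then show "discount r (\<tau> \<omega>) * discount r (rational_hitting_time y (path_after X (enn2real (\<tau> \<omega>)) \<omega>)) =
        discount r (\<tau> \<omega> + hitting_time (\<lambda>t. X (enn2real (\<tau> \<omega>) + t)) (ereal y) \<omega>)"
      by (simp add: discount_add)
  qed
  finally show ?thesis .
qed

text \<open>The first visit after \<open>\<tau>\<close> is never earlier than the first visit of
  all.\<close>

lemma mean_discount_superharmonic:
  assumes x: "x \<in> states" and \<tau>: "stopping_time Fil \<tau>" and "0 < r"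
  shows "(\<integral>\<^sup>+ \<omega>. discount r (\<tau> \<omega>) * mean_discount r y (X (enn2real (\<tau> \<omega>)) \<omega>) \<partial>P x) \<le> mean_discount r y x"
  unfolding mean_discount_stopping[OF x \<tau>] unfolding mean_discount_def
proof (rule nn_integral_mono)
  fix \<omega> assume "\<omega> \<in> space (P x)"
  then have "hitting_time X (ereal y) \<omega> \<le>
      \<tau> \<omega> + hitting_time (\<lambda>t. X (enn2real (\<tau> \<omega>) + t)) (ereal y) \<omega>"
    using hitting_time_shift(1)[of X \<omega> "enn2real (\<tau> \<omega>)" y] continuous_paths[of \<omega>]
    by (cases "\<tau> \<omega>") (auto simp: space_P[OF x])
  then show "discount r (\<tau> \<omega> + hitting_time (\<lambda>t. X (enn2real (\<tau> \<omega>) + t)) (ereal y) \<omega>)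
      \<le> discount r (hitting_time X (ereal y) \<omega>)"
    by (rule discount_antimono[OF \<open>0 < r\<close>])
qed

text \<open>When \<open>\<tau>\<close> does not exceed the hitting time, the first visit after
  \<open>\<tau>\<close> is the first visit of all.\<close>

lemma mean_discount_harmonic:
  assumes x: "x \<in> states" and \<tau>: "stopping_time Fil \<tau>"
    and le: "\<And>\<omega>. \<omega> \<in> space M \<Longrightarrow> \<tau> \<omega> \<le> hitting_time X (ereal y) \<omega>"
  shows "(\<integral>\<^sup>+ \<omega>. discount r (\<tau> \<omega>) * mean_discount r y (X (enn2real (\<tau> \<omega>)) \<omega>) \<partial>P x) = mean_discount r y x"
  unfolding mean_discount_stopping[OF x \<tau>] unfolding mean_discount_def
proof (rule nn_integral_cong)
  fix \<omega> assume "\<omega> \<in> space (P x)"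
  then have "\<tau> \<omega> + hitting_time (\<lambda>t. X (enn2real (\<tau> \<omega>) + t)) (ereal y) \<omega> = hitting_time X (ereal y) \<omega>"
    using hitting_time_shift(2)[of X \<omega> "enn2real (\<tau> \<omega>)" y] continuous_paths[of \<omega>] le[of \<omega>]
    by (cases "\<tau> \<omega>") (auto simp: space_P[OF x] top_unique)
  then show "discount r (\<tau> \<omega> + hitting_time (\<lambda>t. X (enn2real (\<tau> \<omega>) + t)) (ereal y) \<omega>) =
      discount r (hitting_time X (ereal y) \<omega>)"
    by simp
qed

text \<open>The index from which \<open>h z\<close> is represented depends on the state
  \<open>z\<close>, so the inequality passes to \<open>h\<close> by Fatou's lemma.\<close>

lemma superharmonic_limit:
  fixes h :: "real \<Rightarrow> real" and y \<kappa> :: "nat \<Rightarrow> real"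
  assumes x: "x \<in> states" and \<tau>: "stopping_time Fil \<tau>" and "0 < r"
    and lim: "\<And>z. z \<in> states \<Longrightarrow>
      eventually (\<lambda>n. ennreal (\<kappa> n) * mean_discount r (y n) z = ennreal (h z)) sequentially"
  shows "(\<integral>\<^sup>+ \<omega>. discount r (\<tau> \<omega>) * ennreal (h (X (enn2real (\<tau> \<omega>)) \<omega>)) \<partial>P x) \<le> ennreal (h x)"
proof -
  define u where "u n \<omega> = discount r (\<tau> \<omega>) * mean_discount r (y n) (X (enn2real (\<tau> \<omega>)) \<omega>)" for n \<omega>
  note [measurable] = measurable_mean_discount[OF \<tau>] measurable_stopping[OF \<tau>]
  have [measurable]: "u n \<in> borel_measurable (P x)" for n
    unfolding u_def by (intro measurable_P[OF x]) measurable
  have "(\<integral>\<^sup>+ \<omega>. discount r (\<tau> \<omega>) * ennreal (h (X (enn2real (\<tau> \<omega>)) \<omega>)) \<partial>P x) =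
      (\<integral>\<^sup>+ \<omega>. liminf (\<lambda>n. ennreal (\<kappa> n) * u n \<omega>) \<partial>P x)"
  proof (rule nn_integral_cong)
    fix \<omega> assume "\<omega> \<in> space (P x)"
    then have "X (enn2real (\<tau> \<omega>)) \<omega> \<in> states"
      by (simp add: state_space space_P[OF x])
    from lim[OF this] have "eventually (\<lambda>n. discount r (\<tau> \<omega>) * (ennreal (\<kappa> n) * mean_discount r (y n) (X (enn2real (\<tau> \<omega>)) \<omega>)) =
        discount r (\<tau> \<omega>) * ennreal (h (X (enn2real (\<tau> \<omega>)) \<omega>))) sequentially"
      by eventually_elim simp
    moreover have "ennreal (\<kappa> n) * u n \<omega> =
        discount r (\<tau> \<omega>) * (ennreal (\<kappa> n) * mean_discount r (y n) (X (enn2real (\<tau> \<omega>)) \<omega>))" for n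
      by (simp add: u_def mult.left_commute)
    ultimately have "eventually (\<lambda>n. ennreal (\<kappa> n) * u n \<omega> =
        discount r (\<tau> \<omega>) * ennreal (h (X (enn2real (\<tau> \<omega>)) \<omega>))) sequentially"
      by simp
    then show "discount r (\<tau> \<omega>) * ennreal (h (X (enn2real (\<tau> \<omega>)) \<omega>)) = liminf (\<lambda>n. ennreal (\<kappa> n) * u n \<omega>)"
      by (rule liminf_eventually_const[symmetric])
  qed
  also have "\<dots> \<le> liminf (\<lambda>n. \<integral>\<^sup>+ \<omega>. ennreal (\<kappa> n) * u n \<omega> \<partial>P x)"
    by (rule nn_integral_liminf) measurable
  also have "\<dots> \<le> liminf (\<lambda>n. ennreal (\<kappa> n) * mean_discount r (y n) x)"
    unfolding u_def
    using mean_discount_superharmonic[OF x \<tau> \<open>0 < r\<close>] \<open>\<And>n. u n \<in> borel_measurable (P x)\<close>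
    by (intro Liminf_mono always_eventually allI)
      (simp add: nn_integral_cmult u_def[abs_def] mult_left_mono)
  also have "\<dots> = ennreal (h x)"
    by (rule liminf_eventually_const[OF lim[OF x]])
  finally show ?thesis .
qed

end

context natural_regular_diffusion
begin

text \<open>The discount is bounded by \<open>1\<close>, hence integrable, so the assumed Laplace
  transforms carry over to the nonnegative integral.\<close>

lemma mean_discount_eq:
  assumes z: "z \<in> states" and y: "y \<in> states"
  shows "mean_discount r y z = ennreal (if z \<le> y then \<phi> z / \<phi> y else \<psi> z / \<psi> y)"
proof -
  interpret prob_space "P z"
    by (rule prob_space_P[OF z])
  let ?T = "hitting_time X (ereal y)"
  define f where "f \<omega> = exp (- r * enn2real (?T \<omega>)) * indicator {\<omega>. ?T \<omega> < \<infinity>} \<omega>" for \<omega>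
  have f_eq: "f = (\<lambda>\<omega>. enn2real (discount r (?T \<omega>)))"
    by (auto simp: f_def discount_def less_top split: split_indicator)
  have "?T \<in> borel_measurable (P z)"
    by (intro measurable_P[OF z] measurable_stopping stopping_time_hitting_time)
  then have "f \<in> borel_measurable (P z)"
    unfolding f_eq by measurable
  moreover have "norm (f \<omega>) \<le> 1" for \<omega>
    using r_pos by (auto simp: f_def split: split_indicator)
  ultimately have "integrable (P z) f"
    by (intro integrable_const_bound[where B = 1]) auto
  moreover have "ennreal (f \<omega>) = discount r (?T \<omega>)" for \<omega>
    by (auto simp: f_def discount_def less_top split: split_indicator)
  ultimately have "mean_discount r y z = ennreal (integral\<^sup>L (P z) f)"
    unfolding mean_discount_def by (subst nn_integral_eq_integral[symmetric]) (auto simp: f_def)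
  also have "integral\<^sup>L (P z) f = (if z \<le> y then \<phi> z / \<phi> y else \<psi> z / \<psi> y)"
    using hitting_laplace_up[OF z y] hitting_laplace_down[OF z y] unfolding f_def by auto
  finally show ?thesis .
qed

text \<open>Strictness of \<open>l n < z\<close> selects the \<psi> branch of
  \<open>mean_discount_eq\<close> at level \<open>l n\<close>; \<open>z \<le> u n\<close> selects
  the \<phi> branch at level \<open>u n\<close>.\<close>

lemma states_cofinal_sequences:
  obtains l u :: "nat \<Rightarrow> real"
  where "\<And>n. l n \<in> states" "\<And>n. u n \<in> states"
    "\<And>z. z \<in> states \<Longrightarrow> eventually (\<lambda>n. l n < z \<and> z \<le> u n) sequentially"
proof (rule einterval_Icc_approximation[OF interval_nonempty])
  fix u l :: "nat \<Rightarrow> real"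
  assume ul: "\<And>i. l i < u i" "\<And>i. a < l i" "\<And>i. u i < b"
      "(\<lambda>i. ereal (l i)) \<longlonglongrightarrow> a" "(\<lambda>i. ereal (u i)) \<longlonglongrightarrow> b"
  show thesis
  proof (rule that[of l u])
    fix n
    have "ereal (l n) < ereal (u n)"
      using ul(1) by simp
    from less_trans[OF this ul(3)] less_trans[OF ul(2) this]
    show "l n \<in> states" "u n \<in> states"
      using ul(2)[of n] ul(3)[of n] by (auto simp: einterval_iff)
  next
    fix z assume "z \<in> states"
    then have z: "a < ereal z" "ereal z < b"
      by (auto simp: einterval_iff)
    show "eventually (\<lambda>n. l n < z \<and> z \<le> u n) sequentially"
      using order_tendstoD(2)[OF ul(4) z(1)] order_tendstoD(1)[OF ul(5) z(2)]
      by eventually_elim auto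
  qed
qed

text \<open>Once the level \<open>u n\<close> has passed \<open>z\<close>,
  \<open>\<phi> (u n)\<close> times the mean discount of reaching it from \<open>z\<close> is
  \<open>\<phi> z\<close>.\<close>

lemma \<phi>_superharmonic:
  assumes "x \<in> states" "stopping_time Fil \<tau>"
  shows "(\<integral>\<^sup>+ \<omega>. discount r (\<tau> \<omega>) * ennreal (\<phi> (X (enn2real (\<tau> \<omega>)) \<omega>)) \<partial>P x) \<le> ennreal (\<phi> x)"
proof -
  obtain l u where lu: "\<And>n::nat. l n \<in> states" "\<And>n. u n \<in> states"
    "\<And>z. z \<in> states \<Longrightarrow> eventually (\<lambda>n. l n < z \<and> z \<le> u n) sequentially"
    using states_cofinal_sequences by blast
  show ?thesis
  proof (rule superharmonic_limit[OF assms r_pos, where \<kappa> = "\<lambda>n. \<phi> (u n)" and y = u])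
    fix z assume z: "z \<in> states"
    from lu(3)[OF this]
    show "eventually (\<lambda>n. ennreal (\<phi> (u n)) * mean_discount r (u n) z = ennreal (\<phi> z)) sequentially"
      by eventually_elim
        (use \<phi>_pos[OF lu(2)] \<phi>_pos[OF z] in \<open>simp add: mean_discount_eq z lu(2) less_imp_le less_imp_neq[symmetric] flip: ennreal_mult\<close>)
  qed
qed

lemma \<psi>_superharmonic:
  assumes "x \<in> states" "stopping_time Fil \<tau>"
  shows "(\<integral>\<^sup>+ \<omega>. discount r (\<tau> \<omega>) * ennreal (\<psi> (X (enn2real (\<tau> \<omega>)) \<omega>)) \<partial>P x) \<le> ennreal (\<psi> x)"
proof -
  obtain l u where lu: "\<And>n::nat. l n \<in> states" "\<And>n. u n \<in> states"
    "\<And>z. z \<in> states \<Longrightarrow> eventually (\<lambda>n. l n < z \<and> z \<le> u n) sequentially"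
    using states_cofinal_sequences by blast
  show ?thesis
  proof (rule superharmonic_limit[OF assms r_pos, where \<kappa> = "\<lambda>n. \<psi> (l n)" and y = l])
    fix z assume z: "z \<in> states"
    from lu(3)[OF this]
    show "eventually (\<lambda>n. ennreal (\<psi> (l n)) * mean_discount r (l n) z = ennreal (\<psi> z)) sequentially"
      by eventually_elim
        (use \<psi>_pos[OF lu(1)] \<psi>_pos[OF z] in \<open>simp add: mean_discount_eq z lu(1) less_imp_le less_imp_neq[symmetric] flip: ennreal_mult\<close>)
  qed
qed

text \<open>Up to \<open>y\<close>, \<phi> is the multiple \<open>\<phi> y\<close> of the mean
  discount of hitting \<open>y\<close>; the assumption \<open>below\<close> keeps the stopped
  process where this identity holds.\<close>

lemma \<phi>_harmonic_below:
  assumes x: "x \<in> states" and \<tau>: "stopping_time Fil \<tau>" and y: "y \<in> states" "x \<le> y"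
    and le: "\<And>\<omega>. \<omega> \<in> space M \<Longrightarrow> \<tau> \<omega> \<le> hitting_time X (ereal y) \<omega>"
    and below: "\<And>\<omega>. \<omega> \<in> space M \<Longrightarrow> \<tau> \<omega> < \<infinity> \<Longrightarrow> X (enn2real (\<tau> \<omega>)) \<omega> \<le> y"
  shows "(\<integral>\<^sup>+ \<omega>. discount r (\<tau> \<omega>) * ennreal (\<phi> (X (enn2real (\<tau> \<omega>)) \<omega>)) \<partial>P x) = ennreal (\<phi> x)"
proof -
  note [measurable] = measurable_mean_discount[OF \<tau>] measurable_stopping[OF \<tau>]
  have \<phi>_eq: "ennreal (\<phi> z) = ennreal (\<phi> y) * mean_discount r y z" if "z \<in> states" "z \<le> y" for z
    using that \<phi>_pos[OF y(1)] \<phi>_pos[OF that(1)]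
    by (simp add: mean_discount_eq y less_imp_le less_imp_neq[symmetric] flip: ennreal_mult)
  have "(\<integral>\<^sup>+ \<omega>. discount r (\<tau> \<omega>) * ennreal (\<phi> (X (enn2real (\<tau> \<omega>)) \<omega>)) \<partial>P x) =
      (\<integral>\<^sup>+ \<omega>. ennreal (\<phi> y) * (discount r (\<tau> \<omega>) * mean_discount r y (X (enn2real (\<tau> \<omega>)) \<omega>)) \<partial>P x)"
  proof (rule nn_integral_cong)
    fix \<omega> assume "\<omega> \<in> space (P x)"
    then show "discount r (\<tau> \<omega>) * ennreal (\<phi> (X (enn2real (\<tau> \<omega>)) \<omega>)) =
        ennreal (\<phi> y) * (discount r (\<tau> \<omega>) * mean_discount r y (X (enn2real (\<tau> \<omega>)) \<omega>))"
      using below[of \<omega>] \<phi>_eq[of "X (enn2real (\<tau> \<omega>)) \<omega>"]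
      by (cases "\<tau> \<omega>") (auto simp: space_P[OF x] state_space ac_simps)
  qed
  also have "\<dots> = ennreal (\<phi> y) *
      (\<integral>\<^sup>+ \<omega>. discount r (\<tau> \<omega>) * mean_discount r y (X (enn2real (\<tau> \<omega>)) \<omega>) \<partial>P x)"
    by (intro nn_integral_cmult measurable_P[OF x]) measurable
  also have "\<dots> = ennreal (\<phi> x)"
    by (simp add: mean_discount_harmonic[OF x \<tau> le] \<phi>_eq[OF x y(2)])
  finally show ?thesis .
qed

lemma \<psi>_harmonic_above:
  assumes x: "x \<in> states" and \<tau>: "stopping_time Fil \<tau>" and y: "y \<in> states" "y \<le> x"
    and le: "\<And>\<omega>. \<omega> \<in> space M \<Longrightarrow> \<tau> \<omega> \<le> hitting_time X (ereal y) \<omega>"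
    and above: "\<And>\<omega>. \<omega> \<in> space M \<Longrightarrow> \<tau> \<omega> < \<infinity> \<Longrightarrow> y \<le> X (enn2real (\<tau> \<omega>)) \<omega>"
  shows "(\<integral>\<^sup>+ \<omega>. discount r (\<tau> \<omega>) * ennreal (\<psi> (X (enn2real (\<tau> \<omega>)) \<omega>)) \<partial>P x) = ennreal (\<psi> x)"
proof -
  note [measurable] = measurable_mean_discount[OF \<tau>] measurable_stopping[OF \<tau>]
  \<comment> \<open>At \<open>z = y\<close> the formula for the mean discount uses its \<phi>
    branch, which equals \<open>1\<close> as well.\<close>
  have \<psi>_eq: "ennreal (\<psi> z) = ennreal (\<psi> y) * mean_discount r y z" if "z \<in> states" "y \<le> z" for z
    using that \<psi>_pos[OF y(1)] \<psi>_pos[OF that(1)] \<phi>_pos[OF y(1)]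
    by (cases "z = y") (simp_all add: mean_discount_eq y less_imp_le less_imp_neq[symmetric] flip: ennreal_mult)
  have "(\<integral>\<^sup>+ \<omega>. discount r (\<tau> \<omega>) * ennreal (\<psi> (X (enn2real (\<tau> \<omega>)) \<omega>)) \<partial>P x) =
      (\<integral>\<^sup>+ \<omega>. ennreal (\<psi> y) * (discount r (\<tau> \<omega>) * mean_discount r y (X (enn2real (\<tau> \<omega>)) \<omega>)) \<partial>P x)"
  proof (rule nn_integral_cong)
    fix \<omega> assume "\<omega> \<in> space (P x)"
    then show "discount r (\<tau> \<omega>) * ennreal (\<psi> (X (enn2real (\<tau> \<omega>)) \<omega>)) =
        ennreal (\<psi> y) * (discount r (\<tau> \<omega>) * mean_discount r y (X (enn2real (\<tau> \<omega>)) \<omega>))"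
      using above[of \<omega>] \<psi>_eq[of "X (enn2real (\<tau> \<omega>)) \<omega>"]
      by (cases "\<tau> \<omega>") (auto simp: space_P[OF x] state_space ac_simps)
  qed
  also have "\<dots> = ennreal (\<psi> y) *
      (\<integral>\<^sup>+ \<omega>. discount r (\<tau> \<omega>) * mean_discount r y (X (enn2real (\<tau> \<omega>)) \<omega>) \<partial>P x)"
    by (intro nn_integral_cmult measurable_P[OF x]) measurable
  also have "\<dots> = ennreal (\<psi> x)"
    by (simp add: mean_discount_harmonic[OF x \<tau> le] \<psi>_eq[OF x y(2)])
  finally show ?thesis .
qed

end

section \<open>Optimal stopping\<close>

lemma hitting_time_finite_imp_eq:
  assumes "continuous_on {0..} (\<lambda>t. X t \<omega>)" and "hitting_time X y \<omega> < \<infinity>"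
  shows "ereal (X (enn2real (hitting_time X y \<omega>)) \<omega>) = y"
proof (cases y)
  case (real y')
  obtain t where "0 \<le> t" "hitting_time X (ereal y') \<omega> = ennreal t" "X t \<omega> = y'"
    using hitting_time_attained[of X \<omega> y'] assms real by blast
  then show ?thesis
    using real by simp
next
  case PInf
  then show ?thesis
    using assms(2) hitting_time_eq_infinity[of X \<omega> y] by simp
next
  case MInf
  then show ?thesis
    using assms(2) hitting_time_eq_infinity[of X \<omega> y] by simp
qed

lemma ext_expectation_mono_AE:
  assumes "AE \<omega> in M. f \<omega> \<le> g \<omega>"
  shows "ext_expectation M f \<le> ext_expectation M g"
proof -
  have "(\<integral>\<^sup>+ \<omega>. ennreal (f \<omega>) \<partial>M) \<le> (\<integral>\<^sup>+ \<omega>. ennreal (g \<omega>) \<partial>M)"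
    using assms by (intro nn_integral_mono_AE) (auto intro: ennreal_leI)
  moreover have "(\<integral>\<^sup>+ \<omega>. ennreal (- g \<omega>) \<partial>M) \<le> (\<integral>\<^sup>+ \<omega>. ennreal (- f \<omega>) \<partial>M)"
    using assms by (intro nn_integral_mono_AE) (auto elim!: eventually_mono intro!: ennreal_leI)
  ultimately show ?thesis
    unfolding ext_expectation_def by (intro ereal_minus_mono) (simp_all add: less_eq_ennreal.rep_eq)
qed

lemma ext_expectation_nonneg:
  assumes "AE \<omega> in M. 0 \<le> f \<omega>"
  shows "ext_expectation M f = enn2ereal (\<integral>\<^sup>+ \<omega>. ennreal (f \<omega>) \<partial>M)"
proof -
  have "(\<integral>\<^sup>+ \<omega>. ennreal (- f \<omega>) \<partial>M) = (\<integral>\<^sup>+ \<omega>. 0 \<partial>M)"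
    using assms by (intro nn_integral_cong_AE) (auto simp: ennreal_neg)
  then show ?thesis
    by (simp add: ext_expectation_def zero_ennreal.rep_eq)
qed

lemma ennreal_discounted:
  assumes "0 \<le> y"
  shows "ennreal (exp (- r * enn2real (\<tau> \<omega>)) * y * indicator {\<omega>. \<tau> \<omega> < \<infinity>} \<omega>) = discount r (\<tau> \<omega>) * ennreal y"
  using assms by (auto simp: discount_def less_top ennreal_mult'' split: split_indicator)

context natural_regular_diffusion
begin

lemma measurable_X_stopping_states:
  assumes "stopping_time Fil \<tau>"
  shows "(\<lambda>\<omega>. X (enn2real (\<tau> \<omega>)) \<omega>) \<in> measurable M (restrict_space borel states)"
  by (intro measurable_restrict_space2 measurable_X_stopping assms) (auto intro: state_space)

lemma nn_integral_discount_line: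
  assumes x: "x \<in> states" and \<tau>: "stopping_time Fil \<tau>" and "0 \<le> p" "0 \<le> q"
  shows "(\<integral>\<^sup>+ \<omega>. discount r (\<tau> \<omega>) *
      ennreal (p * \<phi> (X (enn2real (\<tau> \<omega>)) \<omega>) + q * \<psi> (X (enn2real (\<tau> \<omega>)) \<omega>)) \<partial>P x) =
    ennreal p * (\<integral>\<^sup>+ \<omega>. discount r (\<tau> \<omega>) * ennreal (\<phi> (X (enn2real (\<tau> \<omega>)) \<omega>)) \<partial>P x) +
    ennreal q * (\<integral>\<^sup>+ \<omega>. discount r (\<tau> \<omega>) * ennreal (\<psi> (X (enn2real (\<tau> \<omega>)) \<omega>)) \<partial>P x)"
proof -
  note [measurable] = measurable_stopping[OF \<tau>]
  have meas: "(\<lambda>\<omega>. discount r (\<tau> \<omega>) * ennreal (f (X (enn2real (\<tau> \<omega>)) \<omega>))) \<in> borel_measurable (P x)"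
    if "continuous_on states f" for f
  proof (rule measurable_P[OF x])
    have [measurable]: "(\<lambda>\<omega>. f (X (enn2real (\<tau> \<omega>)) \<omega>)) \<in> borel_measurable M"
      by (rule measurable_compose[OF measurable_X_stopping_states[OF \<tau>]
            borel_measurable_continuous_on_restrict[OF that]])
    show "(\<lambda>\<omega>. discount r (\<tau> \<omega>) * ennreal (f (X (enn2real (\<tau> \<omega>)) \<omega>))) \<in> borel_measurable M"
      by measurable
  qed
  note meas[OF \<phi>_continuous, measurable] meas[OF \<psi>_continuous, measurable]
  have "(\<integral>\<^sup>+ \<omega>. discount r (\<tau> \<omega>) *
      ennreal (p * \<phi> (X (enn2real (\<tau> \<omega>)) \<omega>) + q * \<psi> (X (enn2real (\<tau> \<omega>)) \<omega>)) \<partial>P x) =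
    (\<integral>\<^sup>+ \<omega>. ennreal p * (discount r (\<tau> \<omega>) * ennreal (\<phi> (X (enn2real (\<tau> \<omega>)) \<omega>))) +
      ennreal q * (discount r (\<tau> \<omega>) * ennreal (\<psi> (X (enn2real (\<tau> \<omega>)) \<omega>))) \<partial>P x)"
  proof (rule nn_integral_cong)
    fix \<omega> assume "\<omega> \<in> space (P x)"
    then have "X (enn2real (\<tau> \<omega>)) \<omega> \<in> states"
      by (simp add: state_space space_P[OF x])
    from \<phi>_pos[OF this] \<psi>_pos[OF this]
    show "discount r (\<tau> \<omega>) * ennreal (p * \<phi> (X (enn2real (\<tau> \<omega>)) \<omega>) + q * \<psi> (X (enn2real (\<tau> \<omega>)) \<omega>)) =
        ennreal p * (discount r (\<tau> \<omega>) * ennreal (\<phi> (X (enn2real (\<tau> \<omega>)) \<omega>))) +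
        ennreal q * (discount r (\<tau> \<omega>) * ennreal (\<psi> (X (enn2real (\<tau> \<omega>)) \<omega>)))"
      using \<open>0 \<le> p\<close> \<open>0 \<le> q\<close> by (simp add: ennreal_mult' distrib_left mult.left_commute)
  qed
  then show ?thesis
    by (simp add: nn_integral_add nn_integral_cmult)
qed

text \<open>Both parts are superharmonic and the coefficients nonnegative; nonnegativity also
  reduces the extended expectation to a nonnegative integral.\<close>

lemma line_superharmonic_majorant:
  assumes "0 \<le> p" "0 \<le> q" and major: "\<And>x. x \<in> states \<Longrightarrow> G x \<le> p * \<phi> x + q * \<psi> x"
  shows "(\<lambda>x. p * \<phi> x + q * \<psi> x) \<in> superharmonic_majorants Fil P X states r G"
proof -
  let ?h = "\<lambda>x. p * \<phi> x + q * \<psi> x"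
  have nonneg: "0 \<le> ?h x" if "x \<in> states" for x
    using \<phi>_pos[OF that] \<psi>_pos[OF that] assms(1,2) by simp
  have cont: "continuous_on states ?h"
    by (intro continuous_intros \<phi>_continuous \<psi>_continuous)
  have "ext_expectation (P x) (\<lambda>\<omega>. exp (- r * enn2real (\<tau> \<omega>)) * ?h (X (enn2real (\<tau> \<omega>)) \<omega>) *
      indicator {\<omega>. \<tau> \<omega> < \<infinity>} \<omega>) \<le> ereal (?h x)"
    if x: "x \<in> states" and \<tau>: "stopping_time Fil \<tau>" for x \<tau>
  proof -
    have in_states: "X (enn2real (\<tau> \<omega>)) \<omega> \<in> states" if "\<omega> \<in> space (P x)" for \<omega>
      using that by (simp add: state_space space_P[OF x])
    have "(\<integral>\<^sup>+ \<omega>. ennreal (exp (- r * enn2real (\<tau> \<omega>)) * ?h (X (enn2real (\<tau> \<omega>)) \<omega>) *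
        indicator {\<omega>. \<tau> \<omega> < \<infinity>} \<omega>) \<partial>P x) =
        (\<integral>\<^sup>+ \<omega>. discount r (\<tau> \<omega>) * ennreal (?h (X (enn2real (\<tau> \<omega>)) \<omega>)) \<partial>P x)"
      by (intro nn_integral_cong ennreal_discounted nonneg in_states)
    also have "\<dots> \<le> ennreal p * ennreal (\<phi> x) + ennreal q * ennreal (\<psi> x)"
      unfolding nn_integral_discount_line[OF x \<tau> assms(1,2)]
      by (intro add_mono mult_left_mono \<phi>_superharmonic \<psi>_superharmonic x \<tau>) auto
    also have "\<dots> = ennreal (?h x)"
      using \<phi>_pos[OF x] \<psi>_pos[OF x] assms(1,2) by (simp add: ennreal_mult')
    finally have "enn2ereal (\<integral>\<^sup>+ \<omega>. ennreal (exp (- r * enn2real (\<tau> \<omega>)) * ?h (X (enn2real (\<tau> \<omega>)) \<omega>) *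
        indicator {\<omega>. \<tau> \<omega> < \<infinity>} \<omega>) \<partial>P x) \<le> ereal (?h x)"
      using nonneg[OF x] by (simp add: less_eq_ennreal.rep_eq)
    moreover have "AE \<omega> in P x. 0 \<le> exp (- r * enn2real (\<tau> \<omega>)) * ?h (X (enn2real (\<tau> \<omega>)) \<omega>) *
        indicator {\<omega>. \<tau> \<omega> < \<infinity>} \<omega>"
      by (intro AE_I2 mult_nonneg_nonneg nonneg in_states) auto
    ultimately show ?thesis
      by (simp only: ext_expectation_nonneg)
  qed
  then show ?thesis
    using major cont borel_measurable_continuous_on_restrict[OF cont]
    by (auto simp: superharmonic_majorants_def r_superharmonic_def)
qed

text \<open>By the Markov property at time \<open>1\<close>, the limit of the discounted reward along the path after
  time \<open>1\<close> is \<open>c\<close> as well, but it is also \<open>exp r * c\<close>. Only integer times are used because the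
  \<open>\<sigma>\<close>-algebra of the path space only sees countably many of them.\<close>

lemma limit_of_discounted_reward_eq_0:
  assumes G: "G \<in> borel_measurable (restrict_space borel states)"
    and limit: "\<And>x. x \<in> states \<Longrightarrow> AE \<omega> in P x. ((\<lambda>t. exp (- r * t) * G (X t \<omega>)) \<longlongrightarrow> c) at_top"
  shows "c = 0"
proof -
  obtain x where x: "x \<in> states"
    using einterval_nonempty[OF interval_nonempty] by auto
  interpret prob_space "P x"
    by (rule prob_space_P[OF x])
  \<comment> \<open>Coordinates in the path space are arbitrary reals, so \<open>G\<close> is
    extended by zero to a Borel function.\<close>
  define g where "g z = G z * indicator states z" for z
  have [measurable]: "g \<in> borel_measurable borel"
    using G unfolding g_def by (simp add: borel_measurable_restrict_space_iff mult.commute)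
  have g_eq: "g z = G z" if "z \<in> states" for z
    using that by (simp add: g_def)
  \<comment> \<open>The \<open>liminf\<close> is measurable on all of path space and vanishes on
    paths whose discounted gain tends to \<open>c\<close>.\<close>
  define f where "f w = liminf (\<lambda>n. ennreal \<bar>exp (- r * real n) * g (w (real n)) - c\<bar>)" for w
  have coord [measurable]: "(\<lambda>w. w (real n)) \<in> borel_measurable path_space" for n
    unfolding path_space_def by (intro measurable_component_singleton) auto
  have f [measurable]: "f \<in> borel_measurable path_space"
    unfolding f_def by measurable
  have lim_int: "(\<lambda>n. exp (- r * real n) * G (X (real n) \<omega>)) \<longlonglongrightarrow> c"
    if "((\<lambda>t. exp (- r * t) * G (X t \<omega>)) \<longlongrightarrow> c) at_top" for \<omega>
    by (rule filterlim_compose[OF that filterlim_real_sequentially])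
  have zero: "(\<integral>\<^sup>+ w. f w \<partial>path_law P X z) = 0" if z: "z \<in> states" for z
  proof -
    have "AE \<omega> in P z. f (path_after X 0 \<omega>) = 0"
      using limit[OF z] AE_space
    proof eventually_elim
      fix \<omega> assume lim: "((\<lambda>t. exp (- r * t) * G (X t \<omega>)) \<longlongrightarrow> c) at_top" and \<omega>: "\<omega> \<in> space (P z)"
      have "(\<lambda>n. ennreal \<bar>exp (- r * real n) * G (X (real n) \<omega>) - c\<bar>) \<longlonglongrightarrow> ennreal \<bar>c - c\<bar>"
        by (intro tendsto_intros lim_int lim)
      moreover have "g (path_after X 0 \<omega> (real n)) = G (X (real n) \<omega>)" for n
        using state_space[of \<omega> "real n"] \<omega> by (simp add: path_after_def g_eq space_P[OF z])
      ultimately show "f (path_after X 0 \<omega>) = 0"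
        unfolding f_def by (simp add: lim_imp_Liminf)
    qed
    then show ?thesis
      unfolding nn_integral_path_law[OF z f]
      using measurable_compose[OF measurable_P[OF z measurable_path_after] f, of "\<lambda>_. 0"]
      by (subst nn_integral_0_iff_AE) auto
  qed
  have "(\<integral>\<^sup>+ \<omega>. discount r 1 * f (path_after X 1 \<omega>) \<partial>P x) =
      (\<integral>\<^sup>+ \<omega>. discount r 1 * (\<integral>\<^sup>+ w. f w \<partial>path_law P X (X 1 \<omega>)) \<partial>P x)"
    using strong_Markov_nn_integral[OF x stopping_time_const[of Fil 1] f measurable_discount]
    by simp
  also have "\<dots> = (\<integral>\<^sup>+ \<omega>. 0 \<partial>P x)"
    by (intro nn_integral_cong) (simp add: zero state_space space_P[OF x])
  finally have "(\<integral>\<^sup>+ \<omega>. discount r 1 * f (path_after X 1 \<omega>) \<partial>P x) = 0"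
    by simp
  moreover have "(\<lambda>\<omega>. f (path_after X 1 \<omega>)) \<in> borel_measurable (P x)"
    by (intro measurable_compose[OF measurable_P[OF x measurable_path_after] f]) auto
  ultimately have "AE \<omega> in P x. discount r 1 * f (path_after X 1 \<omega>) = 0"
    by (subst (asm) nn_integral_0_iff_AE) auto
  moreover have "discount r 1 \<noteq> 0"
    by (simp add: discount_def)
  ultimately have "AE \<omega> in P x. f (path_after X 1 \<omega>) = 0"
    by simp
  then have "AE \<omega> in P x. exp r * c = c"
    using limit[OF x] AE_space
  proof eventually_elim
    fix \<omega> assume f0: "f (path_after X 1 \<omega>) = 0"
      and lim: "((\<lambda>t. exp (- r * t) * G (X t \<omega>)) \<longlongrightarrow> c) at_top" and \<omega>: "\<omega> \<in> space (P x)"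
    have g_after: "g (path_after X 1 \<omega> (real n)) = G (X (1 + real n) \<omega>)" for n
      using state_space[of \<omega> "1 + real n"] \<omega> by (simp add: path_after_def g_eq space_P[OF x])
    \<comment> \<open>Time \<open>n\<close> of the path after time \<open>1\<close> is time
      \<open>Suc n\<close> of the original one, whence the factor \<open>exp r\<close>.\<close>
    have "(\<lambda>n. exp (- r * real (Suc n)) * G (X (real (Suc n)) \<omega>)) \<longlonglongrightarrow> c"
      by (rule LIMSEQ_Suc[OF lim_int[OF lim]])
    then have "(\<lambda>n. exp r * (exp (- r * real (Suc n)) * G (X (real (Suc n)) \<omega>))) \<longlonglongrightarrow> exp r * c"
      by (rule tendsto_mult_left)
    moreover have "exp r * (exp (- r * real (Suc n)) * G (X (real (Suc n)) \<omega>)) =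
        exp (- r * real n) * g (path_after X 1 \<omega> (real n))" for n
      unfolding g_after by (simp add: mult.assoc[symmetric] exp_add[symmetric] algebra_simps)
    ultimately have "(\<lambda>n. exp (- r * real n) * g (path_after X 1 \<omega> (real n))) \<longlonglongrightarrow> exp r * c"
      by (simp only:)
    then have "(\<lambda>n. ennreal \<bar>exp (- r * real n) * g (path_after X 1 \<omega> (real n)) - c\<bar>)
        \<longlonglongrightarrow> ennreal \<bar>exp r * c - c\<bar>"
      by (intro tendsto_ennrealI tendsto_rabs tendsto_diff tendsto_const)
    then have "f (path_after X 1 \<omega>) = ennreal \<bar>exp r * c - c\<bar>"
      unfolding f_def by (simp add: lim_imp_Liminf)
    then show "exp r * c = c"
      using f0 by simp
  qed
  then have "exp r * c = c"
    by simp
  then show ?thesis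
    using r_pos by simp
qed

text \<open>Almost surely the reward is at most the discounted \<open>U\<close> where \<tau> is
  finite and is zero elsewhere; superharmonicity bounds the expectation.\<close>

lemma stopping_value_le_majorant:
  assumes x: "x \<in> states" and U: "U \<in> superharmonic_majorants Fil P X states r G"
    and limit: "AE \<omega> in P x. ((\<lambda>t. exp (- r * t) * G (X t \<omega>)) \<longlongrightarrow> 0) at_top"
  shows "stopping_value Fil P X r G x \<le> ereal (U x)"
  unfolding stopping_value_def
proof (rule SUP_least)
  fix \<tau> :: "'w \<Rightarrow> ennreal" assume "\<tau> \<in> {\<tau>. stopping_time Fil \<tau>}"
  then have \<tau>: "stopping_time Fil \<tau>"
    by simp
  have "ext_expectation (P x) (discounted_reward r X G \<tau>) \<le>
      ext_expectation (P x) (\<lambda>\<omega>. exp (- r * enn2real (\<tau> \<omega>)) * U (X (enn2real (\<tau> \<omega>)) \<omega>) *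
        indicator {\<omega>. \<tau> \<omega> < \<infinity>} \<omega>)"
  proof (rule ext_expectation_mono_AE)
    show "AE \<omega> in P x. discounted_reward r X G \<tau> \<omega> \<le>
        exp (- r * enn2real (\<tau> \<omega>)) * U (X (enn2real (\<tau> \<omega>)) \<omega>) * indicator {\<omega>. \<tau> \<omega> < \<infinity>} \<omega>"
      using limit AE_space
    proof eventually_elim
      fix \<omega> assume lim: "((\<lambda>t. exp (- r * t) * G (X t \<omega>)) \<longlongrightarrow> 0) at_top" and "\<omega> \<in> space (P x)"
      then have "X (enn2real (\<tau> \<omega>)) \<omega> \<in> states"
        by (simp add: state_space space_P[OF x])
      then have "G (X (enn2real (\<tau> \<omega>)) \<omega>) \<le> U (X (enn2real (\<tau> \<omega>)) \<omega>)"
        using U by (simp add: superharmonic_majorants_def)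
      moreover have "Lim at_top (\<lambda>t. exp (- r * t) * G (X t \<omega>)) = 0"
        by (rule tendsto_Lim[OF _ lim]) simp
      ultimately show "discounted_reward r X G \<tau> \<omega> \<le>
          exp (- r * enn2real (\<tau> \<omega>)) * U (X (enn2real (\<tau> \<omega>)) \<omega>) * indicator {\<omega>. \<tau> \<omega> < \<infinity>} \<omega>"
        by (auto simp: discounted_reward_def less_top mult_left_mono)
    qed
  qed
  also have "\<dots> \<le> ereal (U x)"
    using U x \<tau> by (simp add: superharmonic_majorants_def r_superharmonic_def)
  finally show "ext_expectation (P x) (discounted_reward r X G \<tau>) \<le> ereal (U x)" .
qed

lemma stopping_time_exit: "stopping_time Fil (\<lambda>\<omega>. min (hitting_time X \<alpha> \<omega>) (hitting_time X \<beta> \<omega>))"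
  by (intro stopping_time_min stopping_time_hitting_time)

text \<open>At a finite exit time \<open>G = h\<close>. If \<open>p > 0\<close> then \<beta> is a
  state and the \<phi> part is harmonic up to the exit; if \<open>q > 0\<close> the same holds for
  \<alpha> and the \<psi> part. A part without a barrier has coefficient zero.\<close>

lemma exit_reward_eq_line:
  fixes G :: "real \<Rightarrow> real" and p q :: real and \<alpha> \<beta> :: ereal
  defines "h \<equiv> \<lambda>x. p * \<phi> x + q * \<psi> x"
    and "\<tau> \<equiv> \<lambda>\<omega>. min (hitting_time X \<alpha> \<omega>) (hitting_time X \<beta> \<omega>)"
  assumes x: "x \<in> states" and p: "0 \<le> p" and q: "0 \<le> q"
    and \<alpha>: "\<alpha> = a \<and> q = 0 \<or> (\<exists>z\<in>states. \<alpha> = ereal z \<and> z \<le> x \<and> G z = h z)"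
    and \<beta>: "\<beta> = b \<and> p = 0 \<or> (\<exists>z\<in>states. \<beta> = ereal z \<and> x \<le> z \<and> G z = h z)"
    and limit: "AE \<omega> in P x. ((\<lambda>t. exp (- r * t) * G (X t \<omega>)) \<longlongrightarrow> 0) at_top"
  shows "ext_expectation (P x) (discounted_reward r X G \<tau>) = ereal (h x)"
proof -
  have \<tau>: "stopping_time Fil \<tau>"
    unfolding \<tau>_def by (rule stopping_time_exit)
  have bounds: "\<alpha> \<le> ereal x" "ereal x \<le> \<beta>"
    using \<alpha> \<beta> x by (auto simp: einterval_iff)
  have at_exit: "ereal (X (enn2real (\<tau> \<omega>)) \<omega>) \<in> {\<alpha>, \<beta>}" if "\<omega> \<in> space M" "\<tau> \<omega> < \<infinity>" for \<omega>
    using that hitting_time_finite_imp_eq[where X = X, OF continuous_paths[OF that(1)]]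
    unfolding \<tau>_def min_def by (auto split: if_splits)
  \<comment> \<open>The end points \<open>a\<close> and \<open>b\<close> cannot be exit points
    because paths stay in the open interval.\<close>
  have G_eq: "G (X (enn2real (\<tau> \<omega>)) \<omega>) = h (X (enn2real (\<tau> \<omega>)) \<omega>)" if "\<omega> \<in> space M" "\<tau> \<omega> < \<infinity>" for \<omega>
    using at_exit[OF that] \<alpha> \<beta> state_space[OF that(1), of "enn2real (\<tau> \<omega>)"] by (auto simp: einterval_iff)
  have \<phi>_part: "ennreal p * (\<integral>\<^sup>+ \<omega>. discount r (\<tau> \<omega>) * ennreal (\<phi> (X (enn2real (\<tau> \<omega>)) \<omega>)) \<partial>P x) =
      ennreal p * ennreal (\<phi> x)"
  proof (cases "p = 0")
    case False
    then obtain z where z: "z \<in> states" "\<beta> = ereal z" "x \<le> z"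
      using \<beta> by auto
    have "X (enn2real (\<tau> \<omega>)) \<omega> \<le> z" if "\<omega> \<in> space M" "\<tau> \<omega> < \<infinity>" for \<omega>
      using at_exit[OF that] bounds z order_trans[of "\<alpha>" "ereal x" "ereal z"] by auto
    then show ?thesis
      using z by (subst \<phi>_harmonic_below[OF x \<tau>, of z]) (auto simp: \<tau>_def)
  qed simp
  have \<psi>_part: "ennreal q * (\<integral>\<^sup>+ \<omega>. discount r (\<tau> \<omega>) * ennreal (\<psi> (X (enn2real (\<tau> \<omega>)) \<omega>)) \<partial>P x) =
      ennreal q * ennreal (\<psi> x)"
  proof (cases "q = 0")
    case False
    then obtain z where z: "z \<in> states" "\<alpha> = ereal z" "z \<le> x"
      using \<alpha> by auto
    have "z \<le> X (enn2real (\<tau> \<omega>)) \<omega>" if "\<omega> \<in> space M" "\<tau> \<omega> < \<infinity>" for \<omega>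
      using at_exit[OF that] bounds z order_trans[of "ereal z" "ereal x" "\<beta>"] by auto
    then show ?thesis
      using z by (subst \<psi>_harmonic_above[OF x \<tau>, of z]) (auto simp: \<tau>_def)
  qed simp
  have nonneg: "0 \<le> h z" if "z \<in> states" for z
    using \<phi>_pos[OF that] \<psi>_pos[OF that] p q by (simp add: h_def)
  have reward: "AE \<omega> in P x. 0 \<le> discounted_reward r X G \<tau> \<omega> \<and>
      ennreal (discounted_reward r X G \<tau> \<omega>) = discount r (\<tau> \<omega>) * ennreal (h (X (enn2real (\<tau> \<omega>)) \<omega>))"
    using limit AE_space
  proof eventually_elim
    fix \<omega> assume lim: "((\<lambda>t. exp (- r * t) * G (X t \<omega>)) \<longlongrightarrow> 0) at_top" and \<omega>: "\<omega> \<in> space (P x)"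
    then have "X (enn2real (\<tau> \<omega>)) \<omega> \<in> states"
      by (simp add: state_space space_P[OF x])
    note nonneg[OF this]
    moreover have "Lim at_top (\<lambda>t. exp (- r * t) * G (X t \<omega>)) = 0"
      by (rule tendsto_Lim[OF _ lim]) simp
    ultimately show "0 \<le> discounted_reward r X G \<tau> \<omega> \<and>
        ennreal (discounted_reward r X G \<tau> \<omega>) = discount r (\<tau> \<omega>) * ennreal (h (X (enn2real (\<tau> \<omega>)) \<omega>))"
      using G_eq[of \<omega>] \<omega>
      by (auto simp: discounted_reward_def discount_def less_top ennreal_mult'' space_P[OF x])
  qed
  then have "(\<integral>\<^sup>+ \<omega>. ennreal (discounted_reward r X G \<tau> \<omega>) \<partial>P x) =
      (\<integral>\<^sup>+ \<omega>. discount r (\<tau> \<omega>) * ennreal (h (X (enn2real (\<tau> \<omega>)) \<omega>)) \<partial>P x)"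
    by (intro nn_integral_cong_AE) auto
  also have "\<dots> = ennreal p * ennreal (\<phi> x) + ennreal q * ennreal (\<psi> x)"
    unfolding h_def nn_integral_discount_line[OF x \<tau> p q] by (simp only: \<phi>_part \<psi>_part)
  also have "\<dots> = ennreal (h x)"
    using \<phi>_pos[OF x] \<psi>_pos[OF x] p q by (simp add: ennreal_mult' h_def)
  finally have "(\<integral>\<^sup>+ \<omega>. ennreal (discounted_reward r X G \<tau> \<omega>) \<partial>P x) = ennreal (h x)" .
  moreover have "AE \<omega> in P x. 0 \<le> discounted_reward r X G \<tau> \<omega>"
    using reward by auto
  ultimately show ?thesis
    using nonneg[OF x] by (simp add: ext_expectation_nonneg)
qed

end

section \<open>The natural scale\<close>

context natural_regular_diffusion
begin

definition scale :: "real \<Rightarrow> real" where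
  "scale x = \<phi> x / \<psi> x"

lemma scale_pos: "x \<in> states \<Longrightarrow> 0 < scale x"
  by (simp add: scale_def \<phi>_pos \<psi>_pos)

lemma scale_strict_mono: "strict_mono_on states scale"
proof (rule strict_mono_onI)
  fix x y assume xy: "x \<in> states" "y \<in> states" "x < y"
  then have "\<phi> x < \<phi> y" "\<psi> y < \<psi> x"
    using \<phi>_increasing \<psi>_decreasing by (auto simp: monotone_on_def)
  then show "scale x < scale y"
    unfolding scale_def using \<phi>_pos[OF xy(1)] \<psi>_pos[OF xy(2)] by (intro frac_less2) auto
qed

lemma scale_le_iff: "x \<in> states \<Longrightarrow> y \<in> states \<Longrightarrow> scale x \<le> scale y \<longleftrightarrow> x \<le> y"
  using strict_mono_on_less_eq[OF scale_strict_mono] .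

lemma inj_on_scale: "inj_on scale states"
  using scale_strict_mono by (rule strict_mono_on_imp_inj_on)

lemma continuous_on_scale: "continuous_on states scale"
  unfolding scale_def[abs_def] using \<psi>_pos
  by (intro continuous_intros \<phi>_continuous \<psi>_continuous) (metis less_irrefl)

lemma Icc_subset_states: "x \<in> states \<Longrightarrow> y \<in> states \<Longrightarrow> {x..y} \<subseteq> states"
proof
  fix z assume "x \<in> states" "y \<in> states" "z \<in> {x..y}"
  then have "a < ereal x" "ereal x \<le> ereal z" "ereal z \<le> ereal y" "ereal y < b"
    by (auto simp: einterval_iff)
  from less_le_trans[OF this(1,2)] le_less_trans[OF this(3,4)] show "z \<in> states"
    by (simp add: einterval_iff)
qed

text \<open>The blow-up of \<psi> at \<open>a\<close> makes the ratio small and that of \<phi> at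
  \<open>b\<close> makes it large; the intermediate value theorem does the rest.\<close>

lemma scale_surj:
  assumes "0 < y"
  obtains x where "x \<in> states" "scale x = y"
proof -
  obtain x0 where x0: "x0 \<in> states"
    using einterval_nonempty[OF interval_nonempty] by auto
  have ab: "a < ereal x0" "ereal x0 < b"
    using x0 by (auto simp: einterval_iff)
  \<comment> \<open>At a point left of \<open>x0\<close> where \<psi> exceeds this threshold, \<phi>
    is below \<open>\<phi> x0\<close> and so below \<open>y\<close> times \<psi>.\<close>
  have "eventually (\<lambda>e. \<phi> x0 / y < (\<psi> \<circ> real_of_ereal) e) (at_right a)"
    using \<psi>_left by (simp add: filterlim_at_top_dense)
  then obtain l where l: "a < l" "\<And>e. a < e \<Longrightarrow> e < l \<Longrightarrow> \<phi> x0 / y < \<psi> (real_of_ereal e)"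
    unfolding eventually_at_right[OF ab(1)] by auto
  obtain z1 where "a < ereal z1" "ereal z1 < min l (ereal x0)"
    using ereal_dense2[of a "min l (ereal x0)"] l(1) ab(1) by auto
  then have z1: "a < ereal z1" "ereal z1 < l" "z1 < x0"
    by auto
  have z1_states: "z1 \<in> states"
    using z1 less_trans[of "ereal z1" "ereal x0" b] ab(2) by (simp add: einterval_iff)
  have "\<phi> z1 < \<phi> x0"
    using \<phi>_increasing z1_states x0 z1(3) by (auto simp: monotone_on_def)
  moreover have "\<phi> x0 < y * \<psi> z1"
    using l(2)[OF z1(1,2)] assms by (simp add: field_simps)
  ultimately have low: "scale z1 \<le> y"
    using \<psi>_pos[OF z1_states] by (simp add: scale_def pos_divide_le_eq)
  have "eventually (\<lambda>e. y * \<psi> x0 < (\<phi> \<circ> real_of_ereal) e) (at_left b)"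
    using \<phi>_right by (simp add: filterlim_at_top_dense)
  then obtain u where u: "u < b" "\<And>e. u < e \<Longrightarrow> e < b \<Longrightarrow> y * \<psi> x0 < \<phi> (real_of_ereal e)"
    unfolding eventually_at_left[OF ab(2)] by auto
  obtain z2 where "max u (ereal x0) < ereal z2" "ereal z2 < b"
    using ereal_dense2[of "max u (ereal x0)" b] u(1) ab(2) by auto
  then have z2: "u < ereal z2" "ereal z2 < b" "x0 < z2"
    by auto
  have z2_states: "z2 \<in> states"
    using z2 less_trans[of a "ereal x0" "ereal z2"] ab(1) by (simp add: einterval_iff)
  have "\<psi> z2 < \<psi> x0"
    using \<psi>_decreasing z2_states x0 z2(3) by (auto simp: monotone_on_def)
  then have "y * \<psi> z2 < y * \<psi> x0"
    using assms by simp
  also have "\<dots> < \<phi> z2"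
    using u(2)[OF z2(1,2)] by simp
  finally have high: "y \<le> scale z2"
    using \<psi>_pos[OF z2_states] by (simp add: scale_def pos_le_divide_eq)
  have "\<exists>x\<ge>z1. x \<le> z2 \<and> scale x = y"
    using z1(3) z2(3) low high Icc_subset_states[OF z1_states z2_states]
    by (intro IVT' continuous_on_subset[OF continuous_on_scale]) auto
  then show thesis
    using that Icc_subset_states[OF z1_states z2_states] by force
qed

lemma scale_image: "scale ` states = {0<..}"
  using scale_pos scale_surj by (auto simp: image_iff) metis

lemma inv_into_scale:
  assumes "0 < y"
  shows "inv_into states scale y \<in> states" "scale (inv_into states scale y) = y"
  using assms by (auto simp: scale_image intro: inv_into_into f_inv_into_f)

text \<open>A monotone function with open image has no jumps.\<close>

lemma continuous_on_inv_scale: "continuous_on {0<..} (inv_into states scale)"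
proof (rule continuous_onI_mono)
  have "inv_into states scale ` {0<..} = states"
    using inv_into_image_cancel[OF inj_on_scale order_refl] by (simp add: scale_image)
  then show "open (inv_into states scale ` {0<..})"
    by simp
  fix x y :: real assume "x \<in> {0<..}" "y \<in> {0<..}" "x \<le> y"
  then show "inv_into states scale x \<le> inv_into states scale y"
    using inv_into_scale by (subst scale_le_iff[symmetric]) auto
qed

section \<open>The gain in the natural scale and its reflection\<close>

definition scaled_gain :: "(real \<Rightarrow> real) \<Rightarrow> real \<Rightarrow> real" where
  "scaled_gain G = (\<lambda>x. G x / \<psi> x) \<circ> inv_into states scale"

definition reflected_gain :: "(real \<Rightarrow> real) \<Rightarrow> real \<Rightarrow> real" where
  "reflected_gain G = (\<lambda>x. G x / \<phi> x) \<circ> inv_into states (\<lambda>x. - \<psi> x / \<phi> x)"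

lemma scaled_gain_scale: "x \<in> states \<Longrightarrow> scaled_gain G (scale x) = G x / \<psi> x"
  by (simp add: scaled_gain_def inv_into_f_f[OF inj_on_scale])

lemma neg_inverse_scale: "- \<psi> x / \<phi> x = - 1 / scale x"
  by (simp add: scale_def)

text \<open>For the state \<open>x\<close> with \<open>z = - \<psi> x / \<phi> x\<close> one has
  \<open>scale x = - 1 / z\<close>, and \<open>G / \<phi>\<close> is \<open>G / \<psi>\<close> times
  \<open>- z\<close>.\<close>

lemma reflected_gain_eq:
  assumes "z < 0"
  shows "reflected_gain G z = - z * scaled_gain G (- 1 / z)"
proof -
  obtain x where x: "x \<in> states" "scale x = - 1 / z"
    using scale_surj[of "- 1 / z"] assms by (auto simp: divide_neg_neg)
  have "inj_on (\<lambda>x. - \<psi> x / \<phi> x) states"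
    unfolding neg_inverse_scale using inj_on_scale by (auto simp: inj_on_def)
  moreover have z: "- \<psi> x / \<phi> x = z"
    unfolding neg_inverse_scale x(2) using assms by simp
  ultimately have "inv_into states (\<lambda>x. - \<psi> x / \<phi> x) z = x"
    using inv_into_f_f[of "\<lambda>x. - \<psi> x / \<phi> x" states x] x(1) by simp
  then have "reflected_gain G z = G x / \<phi> x"
    by (simp add: reflected_gain_def)
  also have "\<dots> = - z * (G x / \<psi> x)"
    using \<phi>_pos[OF x(1)] \<psi>_pos[OF x(1)] by (simp flip: z)
  also have "G x / \<psi> x = scaled_gain G (- 1 / z)"
    using scaled_gain_scale[OF x(1)] x(2) by simp
  finally show ?thesis .
qed

text \<open>Substituting \<open>z = - 1 / y\<close> turns the limit of the reflected gain at
  \<open>0-\<close> into that of \<open>scaled_gain G y / y\<close> at infinity.\<close>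

lemma sublinear_gain_scaled_gain:
  assumes usc: "usc_on states G" and zero: "(scaled_gain G \<longlongrightarrow> 0) (at_right 0)"
    and infinity: "(reflected_gain G \<longlongrightarrow> 0) (at_left 0)"
  shows "sublinear_gain (scaled_gain G)"
proof
  have "usc_on states (\<lambda>x. G x * (1 / \<psi> x))"
    using \<psi>_pos by (intro usc_on_mult_continuous usc continuous_intros \<psi>_continuous) force+
  then have "usc_on {0<..} (\<lambda>y. G (inv_into states scale y) * (1 / \<psi> (inv_into states scale y)))"
    by (rule usc_on_compose[OF _ continuous_on_inv_scale]) (auto intro: inv_into_scale)
  then show "usc_on {0<..} (scaled_gain G)"
    by (simp add: scaled_gain_def comp_def)
  have "filterlim (\<lambda>y::real. - inverse y) (at_left 0) at_top"
    using filterlim_compose[OF _ filterlim_inverse_at_right_top, of uminus "at_left 0"]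
    by (simp add: filterlim_at_left_to_right[of _ _ "0::real"] filterlim_def at_left_minus[of 0])
  from filterlim_compose[OF infinity this]
  have "((\<lambda>y. reflected_gain G (- inverse y)) \<longlongrightarrow> 0) at_top" .
  then show "((\<lambda>y. scaled_gain G y / y) \<longlongrightarrow> 0) at_top"
    by (rule Lim_transform_eventually)
      (use eventually_gt_at_top[of 0] in \<open>eventually_elim, simp add: reflected_gain_eq field_simps\<close>)
qed (rule zero)

section \<open>Contact points of the minimal line at a fixed state\<close>

context
  fixes G :: "real \<Rightarrow> real" and x p q :: real and C :: "real set"
  assumes usc: "usc_on states G"
    and gain: "sublinear_gain (scaled_gain G)"
    and x: "x \<in> states"
    and line: "supporting_line (scaled_gain G) (scale x) p q"
  defines "C \<equiv> {c \<in> states. ereal (scaled_gain G (scale c)) =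
    concave_biconj {0<..} (scaled_gain G) (scale c)}"
begin

lemma gain_le_line:
  assumes "z \<in> states"
  shows "G z \<le> p * \<phi> z + q * \<psi> z"
  using supporting_lineD(1)[OF line scale_pos[OF assms]] \<psi>_pos[OF assms]
  unfolding scaled_gain_scale[OF assms] by (simp add: scale_def field_simps)

lemma contact_iff:
  assumes "z \<in> states"
  shows "scaled_gain G (scale z) = p * scale z + q \<longleftrightarrow> G z = p * \<phi> z + q * \<psi> z"
  using \<psi>_pos[OF assms] unfolding scaled_gain_scale[OF assms] by (simp add: scale_def field_simps)

text \<open>Where the line meets the gain, the biconjugate does too; \<open>C\<close> may also
  contain points off this line.\<close>

lemma contact_imp_C: "z \<in> states \<Longrightarrow> G z = p * \<phi> z + q * \<psi> z \<Longrightarrow> z \<in> C"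
  using concave_biconj_eq_of_contact[OF line scale_pos] by (simp add: C_def contact_iff)

text \<open>Since \<open>G\<close> never exceeds the line, contact is a superlevel condition, which
  upper semicontinuity makes closed.\<close>

lemma compact_contact:
  assumes "y \<in> states" "z \<in> states"
  shows "compact {c \<in> {y..z}. G c = p * \<phi> c + q * \<psi> c}"
proof -
  have "usc_on states (\<lambda>c. G c + - (p * \<phi> c + q * \<psi> c))"
    by (intro usc_on_add_continuous usc continuous_intros \<phi>_continuous \<psi>_continuous)
  then have "closed {c \<in> {y..z}. 0 \<le> G c + - (p * \<phi> c + q * \<psi> c)}"
    using Icc_subset_states[OF assms] by (intro usc_on_closed_superlevel) auto
  also have "{c \<in> {y..z}. 0 \<le> G c + - (p * \<phi> c + q * \<psi> c)} = {c \<in> {y..z}. G c = p * \<phi> c + q * \<psi> c}"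
    using gain_le_line Icc_subset_states[OF assms] by (force intro: antisym)
  finally have "closed {c \<in> {y..z}. G c = p * \<phi> c + q * \<psi> c}" .
  then have "compact ({y..z} \<inter> {c \<in> {y..z}. G c = p * \<phi> c + q * \<psi> c})"
    by (rule compact_Int_closed[OF compact_Icc])
  also have "{y..z} \<inter> {c \<in> {y..z}. G c = p * \<phi> c + q * \<psi> c} = {c \<in> {y..z}. G c = p * \<phi> c + q * \<psi> c}"
    by auto
  finally show ?thesis .
qed

text \<open>If \<open>q > 0\<close>, the line touches \<open>G\<close> at or before
  \<open>x\<close>. From a contact of the line up to \<open>x\<close> all points of \<open>C\<close>
  are contacts of the line, and compactness provides a largest one.\<close>

lemma left_contact_cases:
  "left_contact a C x = a \<and> q = 0 \<or>
    (\<exists>z\<in>states. left_contact a C x = ereal z \<and> z \<le> x \<and> G z = p * \<phi> z + q * \<psi> z)"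
proof -
  interpret sublinear_gain "scaled_gain G"
    by (rule gain)
  define S where "S = {c \<in> C. a < ereal c \<and> c \<le> x}"
  have S_eq: "S = {c \<in> C. c \<le> x}"
    by (auto simp: S_def C_def einterval_iff)
  have end_point: "q = 0 \<or> (\<exists>k\<in>S. G k = p * \<phi> k + q * \<psi> k)"
  proof (rule disjE[OF contact_left[OF line scale_pos[OF x]]])
    assume "\<exists>k>0. k \<le> scale x \<and> scaled_gain G k = p * k + q"
    then obtain k where k: "0 < k" "k \<le> scale x" "scaled_gain G k = p * k + q"
      by auto
    obtain z where z: "z \<in> states" "scale z = k"
      using scale_surj[OF k(1)] by blast
    with k have "G z = p * \<phi> z + q * \<psi> z" "z \<le> x"
      by (auto simp: contact_iff[symmetric] scale_le_iff[symmetric] x)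
    then show ?thesis
      using contact_imp_C[OF z(1)] by (auto simp: S_eq)
  qed simp
  show ?thesis
  proof (cases "S = {}")
    case True
    then show ?thesis
      using end_point by (auto simp: left_contact_def S_def[symmetric])
  next
    case False
    have on_line: "G c = p * \<phi> c + q * \<psi> c"
      if "c \<in> S" "q = 0 \<or> k \<in> S \<and> k \<le> c \<and> G k = p * \<phi> k + q * \<psi> k" for c k
    proof -
      have c: "c \<in> states" "c \<le> x"
          "ereal (scaled_gain G (scale c)) = concave_biconj {0<..} (scaled_gain G) (scale c)"
        using that(1) by (auto simp: S_eq C_def)
      have "q = 0 \<or> (\<exists>k>0. k \<le> scale c \<and> scaled_gain G k = p * k + q)"
        using that(2) c(1) by (auto simp: S_eq C_def scale_le_iff contact_iff intro!: exI[of _ "scale k"] scale_pos)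
      then have "scaled_gain G (scale c) = p * scale c + q"
        using c by (intro contact_of_biconj_left[OF line]) (auto simp: scale_pos scale_le_iff x)
      then show ?thesis
        using c(1) by (simp add: contact_iff)
    qed
    \<comment> \<open>For \<open>q = 0\<close> every point of \<open>S\<close> lies on the line and
      may serve as \<open>k\<close>.\<close>
    obtain k where k: "k \<in> S" "G k = p * \<phi> k + q * \<psi> k" "q = 0 \<or> k \<in> S"
      using end_point False on_line by blast
    have k_states: "k \<in> states" "k \<le> x"
      using k(1) by (auto simp: S_eq C_def)
    \<comment> \<open>The bound \<open>k\<close> keeps the set compact inside the open interval;
      points of \<open>S\<close> left of \<open>k\<close> do not affect the supremum.\<close>
    define L where "L = {c \<in> {k..x}. G c = p * \<phi> c + q * \<psi> c}"
    have "compact L" "L \<noteq> {}"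
      using compact_contact[OF k_states(1) x] k k_states by (auto simp: L_def)
    then obtain m where m: "m \<in> L" "\<And>c. c \<in> L \<Longrightarrow> c \<le> m"
      using compact_attains_sup by metis
    have m_states: "m \<in> states" "m \<le> x" "k \<le> m" "G m = p * \<phi> m + q * \<psi> m"
      using m(1) Icc_subset_states[OF k_states(1) x] by (auto simp: L_def)
    have "Sup (ereal ` S) = ereal m"
    proof (rule Sup_eqI)
      fix y assume "y \<in> ereal ` S"
      then obtain c where c: "c \<in> S" "y = ereal c"
        by auto
      have "c \<le> m"
      proof (cases "k \<le> c")
        case True
        then have "c \<in> L"
          using on_line[of c k] c(1) k by (auto simp: L_def S_eq)
        then show ?thesis
          by (rule m(2))
      qed (use m_states in simp)
      then show "y \<le> ereal m"
        by (simp add: c)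
    next
      fix y assume "\<And>z. z \<in> ereal ` S \<Longrightarrow> z \<le> y"
      moreover have "m \<in> S"
        using contact_imp_C m_states by (simp add: S_eq)
      ultimately show "ereal m \<le> y"
        by blast
    qed
    then have "left_contact a C x = ereal m"
      using False by (simp add: left_contact_def S_def[symmetric])
    then show ?thesis
      using m_states by blast
  qed
qed

text \<open>The mirror image, with the slope \<open>p\<close> in the role of the intercept and the
  infimum in that of the supremum.\<close>

lemma right_contact_cases:
  "right_contact b C x = b \<and> p = 0 \<or>
    (\<exists>z\<in>states. right_contact b C x = ereal z \<and> x \<le> z \<and> G z = p * \<phi> z + q * \<psi> z)"
proof -
  interpret sublinear_gain "scaled_gain G"
    by (rule gain)
  define S where "S = {c \<in> C. x \<le> c \<and> ereal c < b}"
  have S_eq: "S = {c \<in> C. x \<le> c}"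
    by (auto simp: S_def C_def einterval_iff)
  have end_point: "p = 0 \<or> (\<exists>k\<in>S. G k = p * \<phi> k + q * \<psi> k)"
  proof (rule disjE[OF contact_right[OF line scale_pos[OF x]]])
    assume "\<exists>k\<ge>scale x. scaled_gain G k = p * k + q"
    then obtain k where k: "scale x \<le> k" "scaled_gain G k = p * k + q"
      by auto
    then have "0 < k"
      using scale_pos[OF x] by simp
    then obtain z where z: "z \<in> states" "scale z = k"
      using scale_surj by blast
    with k have "G z = p * \<phi> z + q * \<psi> z" "x \<le> z"
      by (auto simp: contact_iff[symmetric] scale_le_iff[symmetric] x)
    then show ?thesis
      using contact_imp_C[OF z(1)] by (auto simp: S_eq)
  qed simp
  show ?thesis
  proof (cases "S = {}")
    case True
    then show ?thesis
      using end_point by (auto simp: right_contact_def S_def[symmetric])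
  next
    case False
    have on_line: "G c = p * \<phi> c + q * \<psi> c"
      if "c \<in> S" "p = 0 \<or> k \<in> S \<and> c \<le> k \<and> G k = p * \<phi> k + q * \<psi> k" for c k
    proof -
      have c: "c \<in> states" "x \<le> c"
          "ereal (scaled_gain G (scale c)) = concave_biconj {0<..} (scaled_gain G) (scale c)"
        using that(1) by (auto simp: S_eq C_def)
      have "p = 0 \<or> (\<exists>k\<ge>scale c. scaled_gain G k = p * k + q)"
        using that(2) c(1) by (auto simp: S_eq C_def scale_le_iff contact_iff intro!: exI[of _ "scale k"])
      then have "scaled_gain G (scale c) = p * scale c + q"
        using c by (intro contact_of_biconj_right[OF line]) (auto simp: scale_pos scale_le_iff x)
      then show ?thesis
        using c(1) by (simp add: contact_iff)
    qed
    obtain k where k: "k \<in> S" "G k = p * \<phi> k + q * \<psi> k" "p = 0 \<or> k \<in> S"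
      using end_point False on_line by blast
    have k_states: "k \<in> states" "x \<le> k"
      using k(1) by (auto simp: S_eq C_def)
    define L where "L = {c \<in> {x..k}. G c = p * \<phi> c + q * \<psi> c}"
    have "compact L" "L \<noteq> {}"
      using compact_contact[OF x k_states(1)] k k_states by (auto simp: L_def)
    then obtain m where m: "m \<in> L" "\<And>c. c \<in> L \<Longrightarrow> m \<le> c"
      using compact_attains_inf by metis
    have m_states: "m \<in> states" "x \<le> m" "m \<le> k" "G m = p * \<phi> m + q * \<psi> m"
      using m(1) Icc_subset_states[OF x k_states(1)] by (auto simp: L_def)
    have "Inf (ereal ` S) = ereal m"
    proof (rule Inf_eqI)
      fix y assume "y \<in> ereal ` S"
      then obtain c where c: "c \<in> S" "y = ereal c"
        by auto
      have "m \<le> c"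
      proof (cases "c \<le> k")
        case True
        then have "c \<in> L"
          using on_line[of c k] c(1) k by (auto simp: L_def S_eq)
        then show ?thesis
          by (rule m(2))
      qed (use m_states in simp)
      then show "ereal m \<le> y"
        by (simp add: c)
    next
      fix y assume "\<And>z. z \<in> ereal ` S \<Longrightarrow> y \<le> z"
      moreover have "m \<in> S"
        using contact_imp_C m_states by (simp add: S_eq)
      ultimately show "y \<le> ereal m"
        by blast
    qed
    then have "right_contact b C x = ereal m"
      using False by (simp add: right_contact_def S_def[symmetric])
    then show ?thesis
      using m_states by blast
  qed
qed

end

end

theorem theorem3:
  fixes M :: "'w measure" and Fil :: "ennreal \<Rightarrow> 'w measure" and a b :: ereal
    and P :: "real \<Rightarrow> 'w measure" and X :: "real \<Rightarrow> 'w \<Rightarrow> real"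
    and \<mu> D \<phi> \<psi> G F F' W W' :: "real \<Rightarrow> real" and r c :: real
    and I :: "real set" and V Wss Wss' :: "real \<Rightarrow> ereal"
    and astar bstar :: "real \<Rightarrow> ereal" and \<tau>star :: "real \<Rightarrow> 'w \<Rightarrow> ennreal"
  defines "I \<equiv> einterval a b"
    and "F \<equiv> (\<lambda>x. \<phi> x / \<psi> x)"
    and "F' \<equiv> (\<lambda>x. - \<psi> x / \<phi> x)"
    and "W \<equiv> (\<lambda>x. G x / \<psi> x) \<circ> inv_into I F"
    and "W' \<equiv> (\<lambda>x. G x / \<phi> x) \<circ> inv_into I F'"
    and "Wss \<equiv> concave_biconj {0<..} W"
    and "Wss' \<equiv> concave_biconj {..<0} W'"
    and "V \<equiv> stopping_value Fil P X r G"
    and "astar \<equiv> left_contact a {c \<in> I. ereal (W (F c)) = Wss (F c)}"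
    and "bstar \<equiv> right_contact b {c \<in> I. ereal (W (F c)) = Wss (F c)}"
    and "\<tau>star \<equiv> (\<lambda>x \<omega>. min (hitting_time X (astar x) \<omega>) (hitting_time X (bstar x) \<omega>))"
  assumes setting: "natural_regular_diffusion M Fil a b P X \<mu> D r \<phi> \<psi>"
    and usc: "usc_on I G"
    and limit: "\<And>x. x \<in> I \<Longrightarrow> AE \<omega> in P x. ((\<lambda>t. exp (- r * t) * G (X t \<omega>)) \<longlongrightarrow> c) at_top"
    and sup_integrable:
      "\<And>x. x \<in> I \<Longrightarrow> (\<integral>\<^sup>+ \<omega>. (SUP t\<in>{0..}. ennreal \<bar>exp (- r * t) * G (X t \<omega>)\<bar>) \<partial>P x) < \<infinity>"
    and W_0: "(W \<longlongrightarrow> 0) (at_right 0)"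
    and W'_0: "(W' \<longlongrightarrow> 0) (at_left 0)"
  shows "(\<forall>x\<in>I. V x = Wss (F x) * ereal (\<psi> x) \<and> V x = Wss' (F' x) * ereal (\<phi> x)) \<and>
    (\<forall>x\<in>I. stopping_time Fil (\<tau>star x) \<and>
       V x = ext_expectation (P x) (discounted_reward r X G (\<tau>star x))) \<and>
    (\<forall>x\<in>I. V x = (INF U\<in>superharmonic_majorants Fil P X I r G. ereal (U x)))"
proof -
  interpret natural_regular_diffusion M Fil a b P X \<mu> D r \<phi> \<psi>
    by (rule setting)
  have F_eq: "F = scale"
    by (simp add: F_def scale_def[abs_def])
  have W_eq: "W = scaled_gain G"
    unfolding W_def F_eq I_def scaled_gain_def ..
  have W'_eq: "W' = reflected_gain G"
    unfolding W'_def F'_def I_def reflected_gain_def ..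
  have usc': "usc_on states G"
    using usc by (simp add: I_def)
  have gain: "sublinear_gain (scaled_gain G)"
    using sublinear_gain_scaled_gain[OF usc'] W_0 W'_0 by (simp add: W_eq W'_eq)
  have "c = 0"
    using limit_of_discounted_reward_eq_0[OF usc_on_imp_borel_measurable[OF usc']] limit by (simp add: I_def)
  have main: "V x = Wss (F x) * ereal (\<psi> x) \<and> V x = Wss' (F' x) * ereal (\<phi> x) \<and>
      stopping_time Fil (\<tau>star x) \<and> V x = ext_expectation (P x) (discounted_reward r X G (\<tau>star x)) \<and>
      V x = (INF U\<in>superharmonic_majorants Fil P X I r G. ereal (U x))" if "x \<in> I" for x
  proof -
    have x: "x \<in> states"
      using that by (simp add: I_def)
    have limit_0: "AE \<omega> in P x. ((\<lambda>t. exp (- r * t) * G (X t \<omega>)) \<longlongrightarrow> 0) at_top"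
      using limit[OF that] \<open>c = 0\<close> by simp
    obtain p q where line: "supporting_line (scaled_gain G) (scale x) p q"
      using sublinear_gain.supporting_line_exists[OF gain scale_pos[OF x]] .
    define h where "h z = p * \<phi> z + q * \<psi> z" for z
    have pq: "0 \<le> p" "0 \<le> q"
      using sublinear_gain.majorants_nonneg[OF gain] line by (auto simp: supporting_line_def)
    have h_majorant: "h \<in> superharmonic_majorants Fil P X states r G"
      unfolding h_def using gain_le_line[OF usc' gain x line] by (intro line_superharmonic_majorant pq)
    have stopping: "stopping_time Fil (\<tau>star x)"
      unfolding \<tau>star_def by (rule stopping_time_exit)
    have attained: "ext_expectation (P x) (discounted_reward r X G (\<tau>star x)) = ereal (h x)"
      unfolding \<tau>star_def h_def astar_def bstar_def W_eq F_eq I_def Wss_def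
      using left_contact_cases[OF usc' gain x line] right_contact_cases[OF usc' gain x line]
      by (intro exit_reward_eq_line[OF x pq _ _ limit_0])
    \<comment> \<open>The inequalities close into a cycle: \<open>\<tau>star x\<close> attains
      \<open>h x\<close>, every superharmonic majorant bounds \<open>V x\<close>, and
      \<open>h\<close> is such a majorant.\<close>
    have "ereal (h x) \<le> V x"
      unfolding V_def stopping_value_def attained[symmetric] using stopping by (intro SUP_upper) simp
    moreover have "V x \<le> (INF U\<in>superharmonic_majorants Fil P X I r G. ereal (U x))"
      unfolding V_def I_def by (intro INF_greatest stopping_value_le_majorant[OF x _ limit_0])
    moreover have "(INF U\<in>superharmonic_majorants Fil P X I r G. ereal (U x)) \<le> ereal (h x)"
      unfolding I_def by (rule INF_lower[OF h_majorant])
    ultimately have V: "V x = ereal (h x)" and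
        INF: "(INF U\<in>superharmonic_majorants Fil P X I r G. ereal (U x)) = ereal (h x)"
      by (auto intro: antisym)
    \<comment> \<open>Multiplying \<open>p * scale x + q\<close> by \<open>\<psi> x\<close> gives
      \<open>h x\<close>; below, \<open>p + q / scale x\<close> is multiplied by
      \<open>\<phi> x\<close> to the same effect.\<close>
    have "Wss (F x) * ereal (\<psi> x) = ereal (h x)"
      unfolding Wss_def W_eq F_eq concave_biconj_supporting_line[OF line]
      using \<psi>_pos[OF x] by (simp add: h_def scale_def field_simps)
    moreover have "Wss' (F' x) = ereal (p + q / scale x)"
      unfolding Wss'_def W'_eq F'_def neg_inverse_scale
      by (rule concave_biconj_reflected_supporting_line[OF line scale_pos[OF x] reflected_gain_eq])
    then have "Wss' (F' x) * ereal (\<phi> x) = ereal (h x)"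
      using \<phi>_pos[OF x] \<psi>_pos[OF x] by (simp add: h_def scale_def field_simps)
    ultimately show ?thesis
      using V INF stopping attained by simp
  qed
  then show ?thesis
    by blast
qed

end
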